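(* Let $V$ be any Whittaker module (of type $\eta$) for $U$. Then the correspondence $V\longmapsto Z_V$ sets up a bijection between the set of all equivalence classes of Whittaker modules (of type $\eta$) and the set of all ideals of $Z(U)$.
   Context: Let $q\in\mathbb{C}$ with $q\neq 0$ and $q^{2}\neq 1$, and let $m\in\mathbb{N}$. Put $f_m(K)=\frac{K^{m}-K^{-m}}{q-q^{-1}}$. $U=U_q(f_m(K))$ is the associative unital $\mathbb{C}$-algebra generated by $E,F,K^{\pm1}$ with relations $KE=q^{2}EK$, $KF=q^{-2}FK$, $KK^{-1}=K^{-1}K=1$, $EF-FE=f_m(K)$; $Z(U)$ is its center. $U_q(E)$ is the subalgebra of $U$ generated by $E$. Fix a non-singular character of $U_q(E)$, that is, an algebra homomorphism $\eta\colon U_q(E)\to\mathbb{C}$ with $\eta(E)\neq 0$. In a left $U$-module $V$, a vector $0\neq v\in V$ is a Whittaker vector of type $\eta$ if $Ev=\eta(E)v$; if moreover $V=Uv$, then $V$ is called a Whittaker module of type $\eta$ and $v$ a cyclic Whittaker vector. Equivalence of Whittaker modules means isomorphism as $U$-modules. For a $U$-module $V$, $Z_V$ is the intersection of $Z(U)$ with the annihilator of $V$ in $U$, i.e. $Z_V=\{z\in Z(U): zV=0\}$.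
   Formalization: The formal theorem assumes that q is not a root of unity (the claim fails at every root of unity) and replaces "all ideals of Z(U)" by all proper ideals, since Whittaker modules are nonzero and so Z_V is never all of Z(U). *)

theory Defs
  imports
    Complex_Main
    "HOL-Library.Poly_Mapping"
    "HOL-Library.Equipollence"
    "HOL-Algebra.QuotRing"
    "HOL-Algebra.Generated_Rings"
    "HOL-Algebra.Algebraic_Closure_Type"
begin

section \<open>Free associative unital algebras\<close>

text \<open>
  The free monoid is a copy of the type of lists, written additively, because
  \<^theory>\<open>HOL-Library.Poly_Mapping\<close> provides the monoid algebra of an additive monoid: the type
  of finitely supported functions on it, with convolution as multiplication.  Hence
  \<open>'a free_monoid \<Rightarrow>\<^sub>0 complex\<close> is the free associative unital complex algebra
  on \<open>'a\<close>, and \<^term>\<open>Poly_Mapping.single w c\<close> is \<open>c\<close> times the word \<open>w\<close>.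
\<close>

datatype 'a free_monoid = Word (letters: "'a list")

instantiation free_monoid :: (type) monoid_add
begin

definition zero_free_monoid :: "'a free_monoid" where
  "0 = Word []"

definition plus_free_monoid :: "'a free_monoid \<Rightarrow> 'a free_monoid \<Rightarrow> 'a free_monoid" where
  "u + w = Word (letters u @ letters w)"

instance
  by standard (simp_all add: zero_free_monoid_def plus_free_monoid_def)

end

type_synonym 'a free_algebra = "'a free_monoid \<Rightarrow>\<^sub>0 complex"

definition gen :: "'a \<Rightarrow> 'a free_algebra" where
  "gen x = Poly_Mapping.single (Word [x]) 1"

definition const :: "complex \<Rightarrow> 'a free_algebra" where
  "const c = Poly_Mapping.single 0 c"


section \<open>The algebra \<open>U\<^sub>q(f\<^sub>m(K))\<close>\<close>

datatype generator = GE | GF | GK | GKinv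

definition U_relators :: "complex \<Rightarrow> nat \<Rightarrow> generator free_algebra set" where
  "U_relators q m =
    {gen GK * gen GE - const (q\<^sup>2) * gen GE * gen GK,
     gen GK * gen GF - const (inverse (q\<^sup>2)) * gen GF * gen GK,
     gen GK * gen GKinv - 1,
     gen GKinv * gen GK - 1,
     gen GE * gen GF - gen GF * gen GE
       - const (inverse (q - inverse q)) * (gen GK ^ m - gen GKinv ^ m)}"

definition U_ideal :: "complex \<Rightarrow> nat \<Rightarrow> generator free_algebra set" where
  "U_ideal q m = genideal ring_of_type_algebra (U_relators q m)"

type_synonym U_elem = "generator free_algebra set"

definition Uq :: "complex \<Rightarrow> nat \<Rightarrow> U_elem ring" where
  "Uq q m = ring_of_type_algebra Quot U_ideal q m"

definition U_class :: "complex \<Rightarrow> nat \<Rightarrow> generator free_algebra \<Rightarrow> U_elem" where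
  "U_class q m a = U_ideal q m +>\<^bsub>ring_of_type_algebra\<^esub> a"

text \<open>
  The structure of a complex algebra on \<^term>\<open>Uq q m\<close> is given by the central ring homomorphism
  \<open>U_scalar q m\<close> from the complex numbers.
\<close>

definition U_scalar :: "complex \<Rightarrow> nat \<Rightarrow> complex \<Rightarrow> U_elem" where
  "U_scalar q m c = U_class q m (const c)"

definition U_E :: "complex \<Rightarrow> nat \<Rightarrow> U_elem" where
  "U_E q m = U_class q m (gen GE)"

text \<open>The subalgebra \<open>U\<^sub>q(E)\<close>: a subring containing the scalars is a subalgebra.\<close>

definition U_sub_E :: "complex \<Rightarrow> nat \<Rightarrow> U_elem set" where
  "U_sub_E q m = generate_ring (Uq q m) (insert (U_E q m) (range (U_scalar q m)))"

definition nonsingular_character :: "complex \<Rightarrow> nat \<Rightarrow> (U_elem \<Rightarrow> complex) \<Rightarrow> bool" where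
  "nonsingular_character q m \<eta> \<longleftrightarrow>
     \<eta> \<in> ring_hom (Uq q m\<lparr>carrier := U_sub_E q m\<rparr>) ring_of_type_algebra \<and>
     (\<forall>c. \<eta> (U_scalar q m c) = c) \<and>
     \<eta> (U_E q m) \<noteq> 0"

definition ring_center :: "('a, 'b) ring_scheme \<Rightarrow> 'a set" where
  "ring_center R = {z \<in> carrier R. \<forall>a\<in>carrier R. z \<otimes>\<^bsub>R\<^esub> a = a \<otimes>\<^bsub>R\<^esub> z}"

definition center_ring :: "('a, 'b) ring_scheme \<Rightarrow> ('a, 'b) ring_scheme" where
  "center_ring R = R\<lparr>carrier := ring_center R\<rparr>"


section \<open>Left modules over a noncommutative ring\<close>

text \<open>
  The locale \<^locale>\<open>module\<close> requires a commutative ring.  This is the same axiomatization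
  over an arbitrary ring; as there, the fields \<open>mult\<close> and \<open>one\<close> of the module record are
  irrelevant.
\<close>

locale left_module = R?: ring R + M?: abelian_group M
  for R :: "('a, 'b) ring_scheme" (structure) and M :: "('a, 'v, 'c) module_scheme" (structure) +
  assumes smult_closed [simp, intro]:
      "\<lbrakk>a \<in> carrier R; x \<in> carrier M\<rbrakk> \<Longrightarrow> a \<odot>\<^bsub>M\<^esub> x \<in> carrier M"
    and smult_l_distr:
      "\<lbrakk>a \<in> carrier R; b \<in> carrier R; x \<in> carrier M\<rbrakk> \<Longrightarrow>
        (a \<oplus>\<^bsub>R\<^esub> b) \<odot>\<^bsub>M\<^esub> x = a \<odot>\<^bsub>M\<^esub> x \<oplus>\<^bsub>M\<^esub> b \<odot>\<^bsub>M\<^esub> x"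
    and smult_r_distr:
      "\<lbrakk>a \<in> carrier R; x \<in> carrier M; y \<in> carrier M\<rbrakk> \<Longrightarrow>
        a \<odot>\<^bsub>M\<^esub> (x \<oplus>\<^bsub>M\<^esub> y) = a \<odot>\<^bsub>M\<^esub> x \<oplus>\<^bsub>M\<^esub> a \<odot>\<^bsub>M\<^esub> y"
    and smult_assoc:
      "\<lbrakk>a \<in> carrier R; b \<in> carrier R; x \<in> carrier M\<rbrakk> \<Longrightarrow>
        (a \<otimes>\<^bsub>R\<^esub> b) \<odot>\<^bsub>M\<^esub> x = a \<odot>\<^bsub>M\<^esub> (b \<odot>\<^bsub>M\<^esub> x)"
    and smult_one [simp]:
      "x \<in> carrier M \<Longrightarrow> \<one>\<^bsub>R\<^esub> \<odot>\<^bsub>M\<^esub> x = x"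

definition left_module_iso ::
  "('a, 'b) ring_scheme \<Rightarrow> ('a, 'v, 'c) module_scheme \<Rightarrow> ('a, 'w, 'd) module_scheme \<Rightarrow> ('v \<Rightarrow> 'w) set"
where
  "left_module_iso R M N =
    {h. bij_betw h (carrier M) (carrier N) \<and>
        (\<forall>x\<in>carrier M. \<forall>y\<in>carrier M. h (x \<oplus>\<^bsub>M\<^esub> y) = h x \<oplus>\<^bsub>N\<^esub> h y) \<and>
        (\<forall>a\<in>carrier R. \<forall>x\<in>carrier M. h (a \<odot>\<^bsub>M\<^esub> x) = a \<odot>\<^bsub>N\<^esub> h x)}"

definition annihilator ::
  "('a, 'b) ring_scheme \<Rightarrow> ('a, 'v, 'c) module_scheme \<Rightarrow> 'a set" where
  "annihilator R M = {a \<in> carrier R. \<forall>x\<in>carrier M. a \<odot>\<^bsub>M\<^esub> x = \<zero>\<^bsub>M\<^esub>}"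


section \<open>Whittaker modules\<close>

text \<open>
  Modules are taken with underlying set inside a type \<open>'v\<close>.  A cyclic module is a quotient of
  \<^term>\<open>Uq q m\<close>, so every Whittaker module has an isomorphic copy inside \<open>'v\<close> as soon as
  \<open>'v\<close> has at least as many elements as \<^term>\<open>Uq q m\<close>.
  Whittaker vectors are nonzero, so a Whittaker module is nonzero and
  its central annihilator is a proper ideal of the center.
\<close>

definition whittaker_vector ::
  "complex \<Rightarrow> nat \<Rightarrow> (U_elem \<Rightarrow> complex) \<Rightarrow> (U_elem, 'v) module \<Rightarrow> 'v \<Rightarrow> bool" where
  "whittaker_vector q m \<eta> V v \<longleftrightarrow>
     v \<in> carrier V \<and> v \<noteq> \<zero>\<^bsub>V\<^esub> \<and>
     U_E q m \<odot>\<^bsub>V\<^esub> v = U_scalar q m (\<eta> (U_E q m)) \<odot>\<^bsub>V\<^esub> v"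

definition whittaker_modules ::
  "complex \<Rightarrow> nat \<Rightarrow> (U_elem \<Rightarrow> complex) \<Rightarrow> (U_elem, 'v) module set" where
  "whittaker_modules q m \<eta> =
     {V. left_module (Uq q m) V \<and>
         (\<exists>v. whittaker_vector q m \<eta> V v \<and>
              carrier V = {u \<odot>\<^bsub>V\<^esub> v | u. u \<in> carrier (Uq q m)})}"

definition whittaker_equiv ::
  "complex \<Rightarrow> nat \<Rightarrow> (U_elem \<Rightarrow> complex) \<Rightarrow> ((U_elem, 'v) module \<times> (U_elem, 'v) module) set" where
  "whittaker_equiv q m \<eta> =
     {(V, W). V \<in> whittaker_modules q m \<eta> \<and> W \<in> whittaker_modules q m \<eta> \<and>
              left_module_iso (Uq q m) V W \<noteq> {}}"

definition central_annihilator :: "complex \<Rightarrow> nat \<Rightarrow> (U_elem, 'v) module \<Rightarrow> U_elem set" where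
  "central_annihilator q m V = ring_center (Uq q m) \<inter> annihilator (Uq q m) V"


section \<open>Well-formedness of the definitions\<close>

lemma ring_ring_of_type_algebra: "ring (ring_of_type_algebra :: ('a :: ring_1) ring)"
proof -
  have "\<exists>y. x + y = 0" for x :: 'a
    using add.right_inverse by blast
  then show ?thesis
    unfolding ring_of_type_algebra_def using add.right_inverse
    by unfold_locales (auto simp: algebra_simps Units_def)
qed

lemma ring_Uq: "ring (Uq q m)"
proof -
  interpret A: ring "ring_of_type_algebra :: generator free_algebra ring"
    by (rule ring_ring_of_type_algebra)
  have "ideal (U_ideal q m) ring_of_type_algebra"
    unfolding U_ideal_def by (rule A.genideal_ideal) (simp add: ring_of_type_algebra_def)
  then show ?thesis
    unfolding Uq_def by (rule ideal.quotient_is_ring)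
qed

lemma equiv_whittaker_equiv:
  "equiv (whittaker_modules q m \<eta> :: (U_elem, 'v) module set) (whittaker_equiv q m \<eta>)"
proof (rule equivI)
  show "refl_on (whittaker_modules q m \<eta> :: (U_elem, 'v) module set) (whittaker_equiv q m \<eta>)"
  proof (rule refl_onI)
    fix V :: "(U_elem, 'v) module"
    assume "V \<in> whittaker_modules q m \<eta>"
    moreover have "id \<in> left_module_iso (Uq q m) V V"
      by (simp add: left_module_iso_def)
    ultimately show "(V, V) \<in> whittaker_equiv q m \<eta>"
      by (auto simp: whittaker_equiv_def)
  qed
next
  show "whittaker_equiv q m \<eta> \<subseteq>
      (whittaker_modules q m \<eta> :: (U_elem, 'v) module set) \<times> whittaker_modules q m \<eta>"
    by (auto simp: whittaker_equiv_def)
next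
  show "sym (whittaker_equiv q m \<eta> :: ((U_elem, 'v) module \<times> (U_elem, 'v) module) set)"
  proof (rule symI)
    fix V W :: "(U_elem, 'v) module"
    assume VW: "(V, W) \<in> whittaker_equiv q m \<eta>"
    then obtain h where h: "h \<in> left_module_iso (Uq q m) V W"
      and V: "left_module (Uq q m) V"
      by (auto simp: whittaker_equiv_def whittaker_modules_def)
    interpret V: left_module "Uq q m" V by (rule V)
    define g where "g = inv_into (carrier V) h"
    have bij: "bij_betw h (carrier V) (carrier W)"
      using h by (simp add: left_module_iso_def)
    have g: "g y \<in> carrier V" "h (g y) = y" if "y \<in> carrier W" for y
      using that bij unfolding g_def bij_betw_def
      by (auto simp: inv_into_into f_inv_into_f)
    have gh: "g (h x) = x" if "x \<in> carrier V" for x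
      using that bij by (simp add: g_def bij_betw_def)
    have "g (x \<oplus>\<^bsub>W\<^esub> y) = g x \<oplus>\<^bsub>V\<^esub> g y" if "x \<in> carrier W" "y \<in> carrier W" for x y
    proof -
      have "h (g x \<oplus>\<^bsub>V\<^esub> g y) = x \<oplus>\<^bsub>W\<^esub> y"
        using h g that by (simp add: left_module_iso_def)
      then show ?thesis using gh[of "g x \<oplus>\<^bsub>V\<^esub> g y"] g that by simp
    qed
    moreover have "g (a \<odot>\<^bsub>W\<^esub> x) = a \<odot>\<^bsub>V\<^esub> g x" if "a \<in> carrier (Uq q m)" "x \<in> carrier W" for a x
    proof -
      have "h (a \<odot>\<^bsub>V\<^esub> g x) = a \<odot>\<^bsub>W\<^esub> x"
        using h g that by (simp add: left_module_iso_def)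
      then show ?thesis using gh[of "a \<odot>\<^bsub>V\<^esub> g x"] g that by simp
    qed
    ultimately have "g \<in> left_module_iso (Uq q m) W V"
      using bij_betw_inv_into[OF bij] by (simp add: left_module_iso_def g_def)
    then show "(W, V) \<in> whittaker_equiv q m \<eta>"
      using VW by (auto simp: whittaker_equiv_def)
  qed
next
  show "trans (whittaker_equiv q m \<eta> :: ((U_elem, 'v) module \<times> (U_elem, 'v) module) set)"
  proof (rule transI)
    fix V W Y :: "(U_elem, 'v) module"
    assume VW: "(V, W) \<in> whittaker_equiv q m \<eta>" and WX: "(W, Y) \<in> whittaker_equiv q m \<eta>"
    then obtain h k where h: "h \<in> left_module_iso (Uq q m) V W"
      and k: "k \<in> left_module_iso (Uq q m) W Y"
      by (auto simp: whittaker_equiv_def)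
    have "h x \<in> carrier W" if "x \<in> carrier V" for x
      using h that by (auto simp: left_module_iso_def bij_betw_def)
    then have "k \<circ> h \<in> left_module_iso (Uq q m) V Y"
      using h k by (auto simp: left_module_iso_def intro: bij_betw_trans)
    then show "(V, Y) \<in> whittaker_equiv q m \<eta>"
      using VW WX by (auto simp: whittaker_equiv_def)
  qed
qed

end

theory Submission
  imports Defs
begin

text \<open>
  Write \<open>e = \<eta>(E)\<close>.  Let \<open>c(K)\<close> be the combination of \<open>K\<^sup>m\<close> and \<open>K\<^sup>-\<^sup>m\<close> with
  \<open>c(K) - c(q\<^sup>-\<^sup>2K) = f\<^sub>m(K)\<close>.  Then the Casimir element \<open>\<Omega> = FE + c(K)\<close> is central, and the part of
  \<open>U\<close> of weight zero, for the grading with \<open>E\<close> of weight \<open>1\<close> and \<open>F\<close> of weight \<open>-1\<close>, is spanned by the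
  elements \<open>K\<^sup>j \<Omega>\<^sup>i\<close>.

  A Whittaker module is \<open>U/L\<close>, where the left ideal \<open>L\<close> annihilates a cyclic Whittaker vector and so
  contains \<open>E - e\<close>.  Modulo \<open>L\<close> every element of \<open>U\<close> is congruent to one of weight zero: \<open>E\<close> becomes the scalar \<open>e\<close>, and
  \<open>F\<close> becomes \<open>e\<^sup>-\<^sup>1FE = e\<^sup>-\<^sup>1(\<Omega> - c(K))\<close>, because \<open>e\<close> is invertible.  Modulo \<open>L\<close>, moreover,
  \<open>K\<^sup>j p(\<Omega>)\<close> is an eigenvector for left multiplication by \<open>E\<close> with eigenvalue \<open>e q\<^sup>-\<^sup>2\<^sup>j\<close>.  These eigenvalues
  are distinct since \<open>q\<close> is not a root of unity, so a sum of such terms lies in \<open>L\<close> only if each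
  \<open>p(\<Omega>)\<close> does.  Hence \<open>L\<close> is determined by the polynomials \<open>p\<close> with \<open>p(\<Omega>) \<in> L\<close>
  (\<open>whittaker_left_ideal_subset\<close>); as \<open>\<Omega>\<close> is central, these are the \<open>p\<close> with \<open>p(\<Omega>) \<in> Z\<^sub>V\<close>.
  This gives injectivity.

  For surjectivity, the universal Whittaker module is written down explicitly as \<open>\<complex>[x][t\<^sup>\<plusminus>\<^sup>1]\<close>, with \<open>K\<close>
  acting as \<open>t\<close> and \<open>\<Omega>\<close> as \<open>x\<close>.  A central element commutes with \<open>K\<close>, so it has weight zero and is a
  Laurent polynomial in \<open>K\<close> over \<open>\<complex>[\<Omega>]\<close>; it can be read off from its action on the vector \<open>1\<close>, and
  commutation with \<open>E\<close> leaves only the constant term in \<open>K\<close>.  So the center is \<open>\<complex>[\<Omega>]\<close>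
  (\<open>center_eq_cas_poly\<close>).  An ideal of the center is therefore given by an ideal \<open>J\<close> of \<open>\<complex>[x]\<close>, and
  the quotient \<open>(\<complex>[x]/J)[t\<^sup>\<plusminus>\<^sup>1]\<close> is a Whittaker module with that central annihilator
  (\<open>central_ideal_realized\<close>).
\<close>

section \<open>Cyclic modules and their annihilators\<close>

text \<open>
  This is the quotient \<open>R/L\<close>.  Its elements have to lie in the type \<open>'v\<close>, so a coset is represented by
  the image, under an injection of \<open>R\<close> into \<open>'v\<close>, of one chosen element of it.
\<close>
lemma cyclic_module_of_left_ideal:
  fixes R (structure)
  assumes "ring R" and "additive_subgroup L R"
    and left_mult: "\<forall>x\<in>carrier R. \<forall>a\<in>L. x \<otimes> a \<in> L"
    and small: "carrier R \<lesssim> (UNIV :: 'v set)"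
  shows "\<exists>(V :: ('a, 'v) module) v. left_module R V \<and> v \<in> carrier V \<and>
    carrier V = {u \<odot>\<^bsub>V\<^esub> v | u. u \<in> carrier R} \<and>
    (\<forall>u\<in>carrier R. u \<odot>\<^bsub>V\<^esub> v = \<zero>\<^bsub>V\<^esub> \<longleftrightarrow> u \<in> L)"
proof -
  interpret R: ring R by fact
  interpret L: additive_subgroup L R by fact
  obtain i :: "_ \<Rightarrow> 'v" where i: "inj_on i (carrier R)"
    using small by (auto simp: lepoll_def)
  define c where "c a = i (SOME b. b \<in> L +> a)" for a
  have abel: "abelian_subgroup L R"
    by (rule abelian_subgroupI3) (auto intro: L.additive_subgroup_axioms R.abelian_group_axioms)
  interpret L: abelian_subgroup L R by (rule abel)
  have c_eq: "c a = c b \<longleftrightarrow> a \<ominus> b \<in> L" if ab: "a \<in> carrier R" "b \<in> carrier R" for a b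
  proof
    assume "a \<ominus> b \<in> L"
    then have "a \<in> L +> b" using that by (simp add: L.a_rcos_module a_minus_def)
    then show "c a = c b" using R.a_repr_independence[OF _ _ L.a_subgroup, of a b] that by (simp add: c_def)
  next
    have rcos: "(SOME y. y \<in> L +> x) \<in> L +> x" if "x \<in> carrier R" for x
      using L.a_rcos_self[OF that] by (rule someI)
    have car: "L +> x \<subseteq> carrier R" if "x \<in> carrier R" for x
      using that by (rule R.a_r_coset_subset_G[OF L.a_subset])
    assume "c a = c b"
    then have "(SOME y. y \<in> L +> a) = (SOME y. y \<in> L +> b)"
      using i rcos car that unfolding c_def by (meson inj_onD subsetD)
    then obtain y where y: "y \<in> L +> a" "y \<in> L +> b" "y \<in> carrier R"
      using rcos[OF ab(1)] rcos[OF ab(2)] car[OF ab(1)] by auto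
    then have "y \<ominus> a \<in> L" "y \<ominus> b \<in> L"
      using that by (simp_all add: L.a_rcos_module a_minus_def)
    then have "(y \<ominus> b) \<ominus> (y \<ominus> a) \<in> L"
      by (simp add: a_minus_def)
    also have "(y \<ominus> b) \<ominus> (y \<ominus> a) = a \<ominus> b"
      using y that by algebra
    finally show "a \<ominus> b \<in> L" .
  qed
  define d where "d = inv_into (carrier R) c"
  have d: "d (c a) \<in> carrier R" "c (d (c a)) = c a" if "a \<in> carrier R" for a
    using that unfolding d_def by (auto intro: inv_into_into f_inv_into_f)
  then have dL: "d (c a) \<ominus> a \<in> L" if "a \<in> carrier R" for a
    using that c_eq by blast
  define V :: "('a, 'v) module" where
    "V = \<lparr>carrier = c ` carrier R, monoid.mult = (\<lambda>_ _. c \<zero>), one = c \<zero>, ring.zero = c \<zero>,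
      add = (\<lambda>x y. c (d x \<oplus> d y)), module.smult = (\<lambda>u x. c (u \<otimes> d x))\<rparr>"
  have V_simps [simp]: "carrier V = c ` carrier R" "\<zero>\<^bsub>V\<^esub> = c \<zero>"
    by (simp_all add: V_def)
  have V_add [simp]: "c a \<oplus>\<^bsub>V\<^esub> c b = c (a \<oplus> b)" if "a \<in> carrier R" "b \<in> carrier R" for a b
  proof -
    have "(d (c a) \<oplus> d (c b)) \<ominus> (a \<oplus> b) = (d (c a) \<ominus> a) \<oplus> (d (c b) \<ominus> b)"
      using that d by algebra
    also have "\<dots> \<in> L" using that dL by simp
    finally show ?thesis using that d by (simp add: V_def c_eq)
  qed
  have V_smult [simp]: "u \<odot>\<^bsub>V\<^esub> c a = c (u \<otimes> a)" if "u \<in> carrier R" "a \<in> carrier R" for u a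
  proof -
    have "(u \<otimes> d (c a)) \<ominus> (u \<otimes> a) = u \<otimes> (d (c a) \<ominus> a)"
      using that d by algebra
    also have "\<dots> \<in> L" using that dL left_mult by simp
    finally show ?thesis using that d by (simp add: V_def c_eq)
  qed
  have "abelian_group V"
  proof (rule abelian_groupI)
    show "\<exists>y\<in>carrier V. y \<oplus>\<^bsub>V\<^esub> x = \<zero>\<^bsub>V\<^esub>" if "x \<in> carrier V" for x
      using that by (auto simp: R.l_neg intro!: bexI[of _ "\<ominus> _"])
  qed (auto simp: R.a_ac)
  then have "left_module R V"
    using \<open>ring R\<close>
    by (intro left_module.intro left_module_axioms.intro)
       (auto simp: R.l_distr R.r_distr R.m_assoc)
  moreover have "c \<one> \<in> carrier V" by simp
  moreover have "carrier V = {u \<odot>\<^bsub>V\<^esub> c \<one> | u. u \<in> carrier R}"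
    by (auto simp: image_iff) (metis R.r_one V_smult R.one_closed)+
  moreover have "\<forall>u\<in>carrier R. u \<odot>\<^bsub>V\<^esub> c \<one> = \<zero>\<^bsub>V\<^esub> \<longleftrightarrow> u \<in> L"
    by (auto simp: c_eq a_minus_def)
  ultimately show ?thesis by blast
qed

lemma (in left_module) smult_zero_right: "a \<in> carrier R \<Longrightarrow> a \<odot>\<^bsub>M\<^esub> \<zero>\<^bsub>M\<^esub> = \<zero>\<^bsub>M\<^esub>"
  using smult_r_distr[of a "\<zero>\<^bsub>M\<^esub>" "\<zero>\<^bsub>M\<^esub>"] M.add.l_cancel_one' by simp

lemma (in left_module) smult_zero_left: "x \<in> carrier M \<Longrightarrow> \<zero>\<^bsub>R\<^esub> \<odot>\<^bsub>M\<^esub> x = \<zero>\<^bsub>M\<^esub>"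
  using smult_l_distr[of "\<zero>\<^bsub>R\<^esub>" "\<zero>\<^bsub>R\<^esub>" x] M.add.l_cancel_one' by simp

text \<open>Both modules are the quotient of \<open>R\<close> by the common annihilator of the generators.\<close>
lemma cyclic_modules_isomorphic:
  assumes "left_module R V" "left_module R W" "v \<in> carrier V" "w \<in> carrier W"
    and V: "carrier V = {u \<odot>\<^bsub>V\<^esub> v | u. u \<in> carrier R}"
    and W: "carrier W = {u \<odot>\<^bsub>W\<^esub> w | u. u \<in> carrier R}"
    and ann: "\<And>u. u \<in> carrier R \<Longrightarrow> u \<odot>\<^bsub>V\<^esub> v = \<zero>\<^bsub>V\<^esub> \<longleftrightarrow> u \<odot>\<^bsub>W\<^esub> w = \<zero>\<^bsub>W\<^esub>"
  shows "left_module_iso R V W \<noteq> {}"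
proof -
  interpret V: left_module R V by fact
  interpret W: left_module R W by fact
  have minus: "(a \<ominus>\<^bsub>R\<^esub> b) \<odot>\<^bsub>M\<^esub> x = \<zero>\<^bsub>M\<^esub> \<longleftrightarrow> a \<odot>\<^bsub>M\<^esub> x = b \<odot>\<^bsub>M\<^esub> x"
    if "left_module R M" "a \<in> carrier R" "b \<in> carrier R" "x \<in> carrier M"
    for M :: "('a, 'x, 'y) module_scheme" and a b x
  proof -
    interpret M: left_module R M by fact
    have "(a \<ominus>\<^bsub>R\<^esub> b) \<odot>\<^bsub>M\<^esub> x \<oplus>\<^bsub>M\<^esub> b \<odot>\<^bsub>M\<^esub> x = ((a \<ominus>\<^bsub>R\<^esub> b) \<oplus>\<^bsub>R\<^esub> b) \<odot>\<^bsub>M\<^esub> x"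
      using that by (simp add: M.smult_l_distr)
    also have "(a \<ominus>\<^bsub>R\<^esub> b) \<oplus>\<^bsub>R\<^esub> b = a"
      using that by (simp add: V.R.a_assoc a_minus_def V.R.l_neg)
    finally have "(a \<ominus>\<^bsub>R\<^esub> b) \<odot>\<^bsub>M\<^esub> x \<oplus>\<^bsub>M\<^esub> b \<odot>\<^bsub>M\<^esub> x = a \<odot>\<^bsub>M\<^esub> x" .
    then show ?thesis
      using that M.M.add.r_cancel[of "b \<odot>\<^bsub>M\<^esub> x" "(a \<ominus>\<^bsub>R\<^esub> b) \<odot>\<^bsub>M\<^esub> x" "\<zero>\<^bsub>M\<^esub>"] by auto
  qed
  have eq: "a \<odot>\<^bsub>V\<^esub> v = b \<odot>\<^bsub>V\<^esub> v \<longleftrightarrow> a \<odot>\<^bsub>W\<^esub> w = b \<odot>\<^bsub>W\<^esub> w"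
    if "a \<in> carrier R" "b \<in> carrier R" for a b
    using minus[of V a b v] minus[of W a b w] ann[of "a \<ominus>\<^bsub>R\<^esub> b"] that assms by simp
  define h where "h x = (SOME u. u \<in> carrier R \<and> u \<odot>\<^bsub>V\<^esub> v = x) \<odot>\<^bsub>W\<^esub> w" for x
  have h: "h (u \<odot>\<^bsub>V\<^esub> v) = u \<odot>\<^bsub>W\<^esub> w" if "u \<in> carrier R" for u
  proof -
    let ?u = "SOME u'. u' \<in> carrier R \<and> u' \<odot>\<^bsub>V\<^esub> v = u \<odot>\<^bsub>V\<^esub> v"
    have "?u \<in> carrier R \<and> ?u \<odot>\<^bsub>V\<^esub> v = u \<odot>\<^bsub>V\<^esub> v"
      by (rule someI[of _ u]) (simp add: that)
    then show ?thesis using eq[of ?u u] that unfolding h_def by blast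
  qed
  have "bij_betw h (carrier V) (carrier W)"
  proof (rule bij_betw_imageI)
    show "inj_on h (carrier V)"
      by (rule inj_onI) (auto simp: V h eq)
    show "h ` carrier V = carrier W"
      by (auto simp: V W h image_iff) (metis h)
  qed
  moreover have "h (x \<oplus>\<^bsub>V\<^esub> y) = h x \<oplus>\<^bsub>W\<^esub> h y" if xy: "x \<in> carrier V" "y \<in> carrier V" for x y
  proof -
    obtain a b where "a \<in> carrier R" "b \<in> carrier R" "x = a \<odot>\<^bsub>V\<^esub> v" "y = b \<odot>\<^bsub>V\<^esub> v"
      using xy unfolding V by blast
    then show ?thesis
      using h assms by (simp flip: V.smult_l_distr W.smult_l_distr)
  qed
  moreover have "h (u \<odot>\<^bsub>V\<^esub> x) = u \<odot>\<^bsub>W\<^esub> h x" if ux: "u \<in> carrier R" "x \<in> carrier V" for u x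
  proof -
    obtain a where "a \<in> carrier R" "x = a \<odot>\<^bsub>V\<^esub> v"
      using ux unfolding V by blast
    then show ?thesis
      using h assms ux by (simp flip: V.smult_assoc W.smult_assoc)
  qed
  ultimately show ?thesis by (auto simp: left_module_iso_def)
qed

lemma annihilator_iso:
  assumes "left_module R V" "left_module R W" "h \<in> left_module_iso R V W"
  shows "annihilator R V = annihilator R W"
proof -
  interpret V: left_module R V by fact
  interpret W: left_module R W by fact
  have bij: "bij_betw h (carrier V) (carrier W)"
    and add: "\<And>x y. x \<in> carrier V \<Longrightarrow> y \<in> carrier V \<Longrightarrow> h (x \<oplus>\<^bsub>V\<^esub> y) = h x \<oplus>\<^bsub>W\<^esub> h y"
    and smult: "\<And>u x. u \<in> carrier R \<Longrightarrow> x \<in> carrier V \<Longrightarrow> h (u \<odot>\<^bsub>V\<^esub> x) = u \<odot>\<^bsub>W\<^esub> h x"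
    using assms(3) by (auto simp: left_module_iso_def)
  have closed: "h x \<in> carrier W" if "x \<in> carrier V" for x
    using bij that by (auto simp: bij_betw_def)
  have zero: "h \<zero>\<^bsub>V\<^esub> = \<zero>\<^bsub>W\<^esub>"
    using add[of "\<zero>\<^bsub>V\<^esub>" "\<zero>\<^bsub>V\<^esub>"] closed[of "\<zero>\<^bsub>V\<^esub>"] W.M.add.l_cancel_one' by simp
  have zero_iff: "h x = \<zero>\<^bsub>W\<^esub> \<longleftrightarrow> x = \<zero>\<^bsub>V\<^esub>" if "x \<in> carrier V" for x
    using zero bij that unfolding bij_betw_def by (metis inj_onD V.M.zero_closed)
  have "(\<forall>y\<in>carrier W. u \<odot>\<^bsub>W\<^esub> y = \<zero>\<^bsub>W\<^esub>) \<longleftrightarrow> (\<forall>x\<in>carrier V. u \<odot>\<^bsub>V\<^esub> x = \<zero>\<^bsub>V\<^esub>)"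
    if "u \<in> carrier R" for u
  proof -
    have "(\<forall>y\<in>carrier W. u \<odot>\<^bsub>W\<^esub> y = \<zero>\<^bsub>W\<^esub>) \<longleftrightarrow> (\<forall>x\<in>carrier V. u \<odot>\<^bsub>W\<^esub> h x = \<zero>\<^bsub>W\<^esub>)"
      unfolding bij_betw_imp_surj_on[OF bij, symmetric] by simp
    also have "\<dots> \<longleftrightarrow> (\<forall>x\<in>carrier V. u \<odot>\<^bsub>V\<^esub> x = \<zero>\<^bsub>V\<^esub>)"
      using that by (auto simp flip: smult simp: zero_iff)
    finally show ?thesis .
  qed
  then show ?thesis by (auto simp: annihilator_def)
qed

lemma ring_center_ring:
  assumes "ring R"
  shows "ring (center_ring R)"
proof -
  interpret R: ring R by fact
  have "subring (ring_center R) R"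
  proof (rule R.subringI)
    show "ring_center R \<subseteq> carrier R" "\<one>\<^bsub>R\<^esub> \<in> ring_center R"
      by (auto simp: ring_center_def)
  next
    fix x y assume "x \<in> ring_center R" "y \<in> ring_center R"
    then have x: "x \<in> carrier R" "\<And>a. a \<in> carrier R \<Longrightarrow> x \<otimes>\<^bsub>R\<^esub> a = a \<otimes>\<^bsub>R\<^esub> x"
      and y: "y \<in> carrier R" "\<And>a. a \<in> carrier R \<Longrightarrow> y \<otimes>\<^bsub>R\<^esub> a = a \<otimes>\<^bsub>R\<^esub> y"
      by (auto simp: ring_center_def)
    show "\<ominus>\<^bsub>R\<^esub> x \<in> ring_center R"
      using x by (auto simp: ring_center_def R.l_minus R.r_minus)
    show "x \<oplus>\<^bsub>R\<^esub> y \<in> ring_center R"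
      using x y by (auto simp: ring_center_def R.l_distr R.r_distr)
    have "x \<otimes>\<^bsub>R\<^esub> y \<otimes>\<^bsub>R\<^esub> a = a \<otimes>\<^bsub>R\<^esub> (x \<otimes>\<^bsub>R\<^esub> y)" if "a \<in> carrier R" for a
      using x y that by (metis R.m_assoc)
    then show "x \<otimes>\<^bsub>R\<^esub> y \<in> ring_center R"
      unfolding ring_center_def using x(1) y(1) by blast
  qed
  then show ?thesis
    unfolding center_ring_def by (rule R.subring_is_ring)
qed

lemma ideal_central_annihilator:
  assumes "left_module R V"
  shows "ideal (ring_center R \<inter> annihilator R V) (center_ring R)"
proof -
  interpret V: left_module R V by fact
  interpret Z: ring "center_ring R" by (rule ring_center_ring) (rule V.R.ring_axioms)
  have car: "carrier (center_ring R) = ring_center R" "\<zero>\<^bsub>center_ring R\<^esub> = \<zero>\<^bsub>R\<^esub>"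
    "(\<oplus>\<^bsub>center_ring R\<^esub>) = (\<oplus>\<^bsub>R\<^esub>)" "(\<otimes>\<^bsub>center_ring R\<^esub>) = (\<otimes>\<^bsub>R\<^esub>)"
    by (auto simp: center_ring_def)
  have sub: "x \<in> carrier R" if "x \<in> ring_center R" for x
    using that by (simp add: ring_center_def)
  show ?thesis
  proof (rule idealI[OF Z.ring_axioms])
    show "subgroup (ring_center R \<inter> annihilator R V) (add_monoid (center_ring R))"
    proof (rule Z.add.subgroupI)
      show "ring_center R \<inter> annihilator R V \<subseteq> carrier (center_ring R)"
        by (auto simp: car)
      have "\<zero>\<^bsub>R\<^esub> \<in> ring_center R \<inter> annihilator R V"
        by (auto simp: annihilator_def ring_center_def V.smult_zero_left)
      then show "ring_center R \<inter> annihilator R V \<noteq> {}" by blast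
    next
      fix a assume a: "a \<in> ring_center R \<inter> annihilator R V"
      let ?b = "\<ominus>\<^bsub>center_ring R\<^esub> a"
      have b: "?b \<in> ring_center R" "?b \<oplus>\<^bsub>R\<^esub> a = \<zero>\<^bsub>R\<^esub>"
        using a Z.a_inv_closed[of a] Z.l_neg[of a] by (auto simp: car)
      have "?b \<odot>\<^bsub>V\<^esub> x = \<zero>\<^bsub>V\<^esub>" if "x \<in> carrier V" for x
      proof -
        have "(?b \<oplus>\<^bsub>R\<^esub> a) \<odot>\<^bsub>V\<^esub> x = ?b \<odot>\<^bsub>V\<^esub> x"
          using V.smult_l_distr[of ?b a x] a b(1) that sub by (simp add: annihilator_def)
        then show ?thesis using b(2) that by (simp add: V.smult_zero_left)
      qed
      then show "?b \<in> ring_center R \<inter> annihilator R V"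
        using b sub by (auto simp: annihilator_def)
    next
      fix a b assume "a \<in> ring_center R \<inter> annihilator R V" "b \<in> ring_center R \<inter> annihilator R V"
      then show "a \<oplus>\<^bsub>center_ring R\<^esub> b \<in> ring_center R \<inter> annihilator R V"
        using Z.a_closed[of a b] by (auto simp: car annihilator_def V.smult_l_distr)
    qed
  next
    fix a x assume ax: "a \<in> ring_center R \<inter> annihilator R V" "x \<in> carrier (center_ring R)"
    then show "x \<otimes>\<^bsub>center_ring R\<^esub> a \<in> ring_center R \<inter> annihilator R V"
      using Z.m_closed[of x a] sub by (auto simp: car annihilator_def V.smult_assoc V.smult_zero_right)
    show "a \<otimes>\<^bsub>center_ring R\<^esub> x \<in> ring_center R \<inter> annihilator R V"
      using ax Z.m_closed[of a x] sub by (auto simp: car annihilator_def V.smult_assoc)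
  qed
qed


section \<open>The free algebra\<close>

lemma const_0 [simp]: "const 0 = 0"
  by (simp add: const_def)

lemma const_1 [simp]: "const 1 = 1"
  by (simp add: const_def)

lemma const_add: "const (a + b) = const a + const b"
  by (simp add: const_def single_add)

lemma const_uminus: "const (- a) = - const a"
  by (simp add: const_def single_uminus)

lemma const_diff: "const (a - b) = const a - const b"
  by (simp add: const_def single_diff)

lemma const_mult: "const (a * b) = const a * const b"
  by (simp add: const_def mult_single)

lemma single_eq_const_mult: "Poly_Mapping.single w c = const c * Poly_Mapping.single w 1"
  by (simp add: const_def mult_single)

lemma poly_mapping_eq_sum_single:
  "a = (\<Sum>w\<in>Poly_Mapping.keys a. Poly_Mapping.single w (Poly_Mapping.lookup a w))"
  by (rule poly_mapping_eqI)
     (auto simp: lookup_sum lookup_single when_def in_keys_iff sum.delta)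

lemma poly_mapping_additive_induct [case_names zero add single]:
  assumes "P 0" and "\<And>a b. P a \<Longrightarrow> P b \<Longrightarrow> P (a + b)" and "\<And>w c. P (Poly_Mapping.single w c)"
  shows "P (a :: _ \<Rightarrow>\<^sub>0 _ :: comm_monoid_add)"
proof -
  have "P (\<Sum>w\<in>A. Poly_Mapping.single w (Poly_Mapping.lookup a w))" if "finite A" for A
    using that by (induction A) (auto intro: assms)
  then show ?thesis
    by (subst poly_mapping_eq_sum_single) simp
qed

lemma const_commute: "const c * a = a * const c"
  by (induction a rule: poly_mapping_additive_induct)
     (auto simp: algebra_simps const_def mult_single)

lemma const_left_commute: "a * (const c * b) = const c * (a * b)"
  by (metis const_commute mult.assoc)

lemma const_const_mult: "const c * (const d * a) = const (c * d) * a"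
  by (simp add: const_mult mult.assoc)

lemma gen_mult_single: "gen x * Poly_Mapping.single (Word w) c = Poly_Mapping.single (Word (x # w)) c"
  by (simp add: gen_def mult_single plus_free_monoid_def)

lemma single_Nil: "Poly_Mapping.single (Word []) c = const c"
  by (simp add: const_def zero_free_monoid_def)

lemma free_algebra_induct [case_names one add const_mult gen_mult]:
  assumes one: "P 1"
    and add: "\<And>a b. P a \<Longrightarrow> P b \<Longrightarrow> P (a + b)"
    and const_mult: "\<And>c a. P a \<Longrightarrow> P (const c * a)"
    and gen_mult: "\<And>x a. P a \<Longrightarrow> P (gen x * a)"
  shows "P (a :: 'a free_algebra)"
proof (induction a rule: poly_mapping_additive_induct)
  case zero
  then show ?case using const_mult[OF one, of 0] by simp
next
  case (single w c)
  obtain xs where w: "w = Word xs" by (cases w)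
  have "P (Poly_Mapping.single (Word xs) 1)"
    by (induction xs) (auto simp: single_Nil one gen_mult_single[symmetric] intro: gen_mult)
  from const_mult[OF this, of c] show ?case
    by (simp add: w single_eq_const_mult[of _ c])
qed (rule add)

text \<open>
  Eigenvectors of \<open>T\<close> for distinct eigenvalues are independent modulo a \<open>T\<close>-invariant subspace \<open>L\<close>.
  Two instances matter: conjugation by \<open>K\<close> separates weights, and left multiplication by \<open>E\<close>
  separates the powers of \<open>K\<close> in front of a Whittaker vector.
\<close>
lemma eigenvectors_independent:
  fixes L :: "'a free_algebra set" and T :: "'a free_algebra \<Rightarrow> 'a free_algebra"
  assumes add: "\<And>a b. a \<in> L \<Longrightarrow> b \<in> L \<Longrightarrow> a + b \<in> L"
    and scale: "\<And>c a. a \<in> L \<Longrightarrow> const c * a \<in> L"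
    and T_add: "\<And>a b. T (a + b) = T a + T b"
    and T_L: "\<And>a. a \<in> L \<Longrightarrow> T a \<in> L"
    and T_scale: "\<And>c a. T (const c * a) = const c * T a"
    and "finite S" and "inj_on \<mu> S"
    and "\<And>i. i \<in> S \<Longrightarrow> T (f i) - const (\<mu> i) * f i \<in> L"
    and "sum f S \<in> L" and "i \<in> S"
  shows "f i \<in> L"
  using assms(6-)
proof (induction S arbitrary: f i rule: finite_induct)
  case (insert k S)
  have diff: "a - b \<in> L" if "a \<in> L" "b \<in> L" for a b
    using add[OF that(1) scale[OF that(2), of "-1"]] by (simp add: const_uminus)
  have "0 \<in> L"
    using scale[OF insert.prems(3), of 0] by simp
  have T_0: "T 0 = 0"
    using T_add[of 0 0] by simp
  have T_sum: "T (sum g A) = (\<Sum>j\<in>A. T (g j))" for g :: "'b \<Rightarrow> _" and A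
    by (induction A rule: infinite_finite_induct) (auto simp: T_0 T_add)
  have sum_L: "sum g A \<in> L" if "\<And>j. j \<in> A \<Longrightarrow> g j \<in> L" for g :: "'b \<Rightarrow> _" and A
    using that by (induction A rule: infinite_finite_induct) (auto intro: add \<open>0 \<in> L\<close>)
  have in_S: "f j \<in> L" if "j \<in> S" for j
  proof -
    \<comment> \<open>Applying \<open>T - \<mu> k\<close> to the sum removes the term at \<open>k\<close> and multiplies the others by
      nonzero factors, which leaves a sum over \<open>S\<close>.\<close>
    define g where "g j = const (\<mu> j - \<mu> k) * f j" for j
    have "(\<Sum>j\<in>insert k S. T (f j)) - const (\<mu> k) * sum f (insert k S) \<in> L"
      using diff[OF T_L[OF insert.prems(3)] scale[OF insert.prems(3)]] by (simp only: T_sum)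
    then have "(\<Sum>j\<in>insert k S. T (f j) - const (\<mu> k) * f j) \<in> L"
      by (simp only: sum_subtractf sum_distrib_left)
    moreover have "(\<Sum>j\<in>insert k S. T (f j) - const (\<mu> j) * f j) \<in> L"
      by (rule sum_L) (rule insert.prems(2))
    ultimately have "(\<Sum>j\<in>insert k S. T (f j) - const (\<mu> k) * f j)
        - (\<Sum>j\<in>insert k S. T (f j) - const (\<mu> j) * f j) \<in> L"
      by (rule diff)
    also have "(\<Sum>j\<in>insert k S. T (f j) - const (\<mu> k) * f j)
        - (\<Sum>j\<in>insert k S. T (f j) - const (\<mu> j) * f j) = sum g S"
      using insert.hyps
      by (simp add: g_def const_diff left_diff_distrib flip: sum_subtractf)
    finally have sum_g: "sum g S \<in> L" .
    have "T (g j) - const (\<mu> j) * g j \<in> L" if "j \<in> S" for j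
    proof -
      have "T (g j) - const (\<mu> j) * g j = const (\<mu> j - \<mu> k) * (T (f j) - const (\<mu> j) * f j)"
        by (simp add: g_def T_scale right_diff_distrib const_const_mult mult.commute)
      also have "\<dots> \<in> L"
        using that by (intro scale insert.prems(2)) simp
      finally show ?thesis .
    qed
    then have "g j \<in> L"
      using insert.IH[of g j] insert.prems(1) sum_g \<open>j \<in> S\<close> by simp
    then have "const (inverse (\<mu> j - \<mu> k)) * g j \<in> L"
      by (rule scale)
    moreover have "\<mu> j \<noteq> \<mu> k"
      using insert.prems(1) insert.hyps that unfolding inj_on_def by (metis insertI1 insertI2)
    ultimately show ?thesis
      by (simp add: g_def const_const_mult)
  qed
  have "f k = sum f (insert k S) - sum f S"
    using insert.hyps by simp
  also have "\<dots> \<in> L"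
    by (rule diff[OF insert.prems(3) sum_L]) (rule in_S)
  finally show ?case
    using in_S insert.prems(4) by blast
qed simp


section \<open>Congruence modulo the defining relations\<close>

lemma ideal_U_ideal: "ideal (U_ideal q m) ring_of_type_algebra"
proof -
  interpret A: ring "ring_of_type_algebra :: generator free_algebra ring"
    by (rule ring_ring_of_type_algebra)
  show ?thesis
    unfolding U_ideal_def by (rule A.genideal_ideal) (simp add: ring_of_type_algebra_def)
qed

lemma U_relators_subset_ideal: "U_relators q m \<subseteq> U_ideal q m"
proof -
  interpret A: ring "ring_of_type_algebra :: generator free_algebra ring"
    by (rule ring_ring_of_type_algebra)
  show ?thesis
    unfolding U_ideal_def by (rule A.genideal_self) (simp add: ring_of_type_algebra_def)
qed

lemma additive_inverse_type_algebra:
  "\<ominus>\<^bsub>ring_of_type_algebra\<^esub> (a :: 'a :: ring_1) = - a"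
proof -
  interpret A: ring "ring_of_type_algebra :: 'a ring"
    by (rule ring_ring_of_type_algebra)
  show ?thesis
    by (rule A.minus_equality) (simp_all add: ring_of_type_algebra_def)
qed

lemma U_ideal_0: "0 \<in> U_ideal q m"
  and U_ideal_add: "a \<in> U_ideal q m \<Longrightarrow> b \<in> U_ideal q m \<Longrightarrow> a + b \<in> U_ideal q m"
  and U_ideal_mult_left: "a \<in> U_ideal q m \<Longrightarrow> x * a \<in> U_ideal q m"
  and U_ideal_mult_right: "a \<in> U_ideal q m \<Longrightarrow> a * x \<in> U_ideal q m"
proof -
  interpret I: ideal "U_ideal q m" ring_of_type_algebra by (rule ideal_U_ideal)
  show "0 \<in> U_ideal q m"
    using additive_subgroup.zero_closed[OF I.is_additive_subgroup] by (simp add: ring_of_type_algebra_def)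
  show "a + b \<in> U_ideal q m" if "a \<in> U_ideal q m" "b \<in> U_ideal q m"
    using additive_subgroup.a_closed[OF I.is_additive_subgroup that] by (simp add: ring_of_type_algebra_def)
  show "x * a \<in> U_ideal q m" if "a \<in> U_ideal q m"
    using I.I_l_closed[OF that, of x] by (simp add: ring_of_type_algebra_def)
  show "a * x \<in> U_ideal q m" if "a \<in> U_ideal q m"
    using I.I_r_closed[OF that, of x] by (simp add: ring_of_type_algebra_def)
qed

lemma U_ideal_uminus: "a \<in> U_ideal q m \<Longrightarrow> - a \<in> U_ideal q m"
  using U_ideal_mult_left[of a q m "- 1"] by simp

lemma U_ideal_diff: "a \<in> U_ideal q m \<Longrightarrow> b \<in> U_ideal q m \<Longrightarrow> a - b \<in> U_ideal q m"
  using U_ideal_add[of a q m "- b"] U_ideal_uminus[of b q m] by simp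

lemma U_class_eq_iff: "U_class q m a = U_class q m b \<longleftrightarrow> a - b \<in> U_ideal q m"
proof -
  interpret A: ring "ring_of_type_algebra :: generator free_algebra ring"
    by (rule ring_ring_of_type_algebra)
  show ?thesis
    using A.quotient_eq_iff_same_a_r_cos[OF ideal_U_ideal, of a b q m]
    by (simp add: U_class_def a_minus_def additive_inverse_type_algebra)
       (simp add: ring_of_type_algebra_def)
qed

lemma U_class_hom: "U_class q m \<in> ring_hom ring_of_type_algebra (Uq q m)"
  using ideal.rcos_ring_hom[OF ideal_U_ideal, of q m] by (simp add: U_class_def[abs_def] Uq_def)

lemma U_class_closed [simp]: "U_class q m a \<in> carrier (Uq q m)"
  using ring_hom_closed[OF U_class_hom, of a] by (simp add: ring_of_type_algebra_def)

lemma U_class_mult: "U_class q m (a * b) = U_class q m a \<otimes>\<^bsub>Uq q m\<^esub> U_class q m b"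
  using ring_hom_mult[OF U_class_hom, of a b] by (simp add: ring_of_type_algebra_def)

lemma U_class_add: "U_class q m (a + b) = U_class q m a \<oplus>\<^bsub>Uq q m\<^esub> U_class q m b"
  using ring_hom_add[OF U_class_hom, of a b] by (simp add: ring_of_type_algebra_def)

lemma U_class_1: "U_class q m 1 = \<one>\<^bsub>Uq q m\<^esub>"
  using ring_hom_one[OF U_class_hom] by (simp add: ring_of_type_algebra_def)

lemma U_class_0: "U_class q m 0 = \<zero>\<^bsub>Uq q m\<^esub>"
proof -
  interpret U: ring "Uq q m" by (rule ring_Uq)
  have "U_class q m 0 \<oplus>\<^bsub>Uq q m\<^esub> U_class q m 0 = U_class q m 0"
    by (simp flip: U_class_add)
  then show ?thesis
    by (simp add: U.add.l_cancel_one')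
qed

lemma carrier_UqE:
  assumes "u \<in> carrier (Uq q m)"
  obtains a where "u = U_class q m a"
  using assms by (auto simp: Uq_def FactRing_def A_RCOSETS_def' U_class_def ring_of_type_algebra_def)

text \<open>
  The computations in \<open>U\<close> are carried out on representatives in the free algebra, where \<open>a \<doteq> b\<close> means
  that \<open>a\<close> and \<open>b\<close> have the same class in \<open>U\<close>.
\<close>
locale generic_U =
  fixes q :: complex and m :: nat
  assumes q_nonzero: "q \<noteq> 0"
    and not_root_of_unity: "n > 0 \<Longrightarrow> q ^ n \<noteq> 1"
begin

abbreviation E where "E \<equiv> gen GE"
abbreviation F where "F \<equiv> gen GF"
abbreviation K where "K \<equiv> gen GK"
abbreviation Kinv where "Kinv \<equiv> gen GKinv"

definition cong (infix "\<doteq>" 50) where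
  "a \<doteq> b \<longleftrightarrow> a - b \<in> U_ideal q m"

lemma cong_iff_class: "a \<doteq> b \<longleftrightarrow> U_class q m a = U_class q m b"
  by (simp add: cong_def U_class_eq_iff)

lemma cong_refl [simp]: "a \<doteq> a"
  by (simp add: cong_iff_class)

lemma cong_sym: "a \<doteq> b \<Longrightarrow> b \<doteq> a"
  by (simp add: cong_iff_class)

lemma cong_trans [trans]: "a \<doteq> b \<Longrightarrow> b \<doteq> c \<Longrightarrow> a \<doteq> c"
  by (simp add: cong_iff_class)

lemma cong_add: "a \<doteq> a' \<Longrightarrow> b \<doteq> b' \<Longrightarrow> a + b \<doteq> a' + b'"
  by (simp add: cong_iff_class U_class_add)

lemma cong_mult: "a \<doteq> a' \<Longrightarrow> b \<doteq> b' \<Longrightarrow> a * b \<doteq> a' * b'"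
  by (simp add: cong_iff_class U_class_mult)

lemmas cong_mult_left = cong_mult[OF cong_refl]
lemmas cong_mult_right = cong_mult[OF _ cong_refl]

lemma cong_sum: "(\<And>i. i \<in> S \<Longrightarrow> f i \<doteq> g i) \<Longrightarrow> sum f S \<doteq> sum g S"
  by (induction S rule: infinite_finite_induct) (auto intro: cong_add)

lemma cong_0_iff: "a \<doteq> 0 \<longleftrightarrow> a \<in> U_ideal q m"
  by (simp add: cong_def)

lemma q2_powi_neq_1:
  assumes "j \<noteq> 0"
  shows "(q\<^sup>2) powi j \<noteq> 1"
proof (cases "j > 0")
  case True
  then show ?thesis
    using not_root_of_unity[of "2 * nat j"] by (simp add: power_int_def power_mult)
next
  case False
  then show ?thesis
    using assms not_root_of_unity[of "2 * nat (- j)"] q_nonzero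
    by (simp add: power_int_def power_mult power_inverse)
qed

lemma q2_powi_inj: "(q\<^sup>2) powi i = (q\<^sup>2) powi j \<Longrightarrow> i = j"
  using q2_powi_neq_1[of "i - j"] q_nonzero by (cases "i = j") (simp_all add: power_int_diff)

lemma K_E: "K * E \<doteq> const (q\<^sup>2) * (E * K)"
  and K_F: "K * F \<doteq> const (inverse (q\<^sup>2)) * (F * K)"
  and K_Kinv: "K * Kinv \<doteq> 1"
  and Kinv_K: "Kinv * K \<doteq> 1"
  and E_F: "E * F \<doteq> F * E + const (inverse (q - inverse q)) * (K ^ m - Kinv ^ m)"
  using U_relators_subset_ideal[of q m]
  by (auto simp: U_relators_def cong_def mult.assoc diff_diff_eq)

lemma E_K: "E * K \<doteq> const (inverse (q\<^sup>2)) * (K * E)"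
proof -
  have "E * K = const (inverse (q\<^sup>2)) * (const (q\<^sup>2) * (E * K))"
    using q_nonzero by (simp add: const_const_mult)
  also have "\<dots> \<doteq> const (inverse (q\<^sup>2)) * (K * E)"
    by (rule cong_mult_left) (rule cong_sym[OF K_E])
  finally show ?thesis .
qed

lemma F_K: "F * K \<doteq> const (q\<^sup>2) * (K * F)"
proof -
  have "F * K = const (q\<^sup>2) * (const (inverse (q\<^sup>2)) * (F * K))"
    using q_nonzero by (simp add: const_const_mult)
  also have "\<dots> \<doteq> const (q\<^sup>2) * (K * F)"
    by (rule cong_mult_left) (rule cong_sym[OF K_F])
  finally show ?thesis .
qed

lemma q_commute_inverse:
  assumes "A * B \<doteq> const c * (B * A)" "c \<noteq> 0" "B * C \<doteq> 1" "C * B \<doteq> 1"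
  shows "A * C \<doteq> const (inverse c) * (C * A)"
proof -
  have "A * C = 1 * (A * C)" by simp
  also have "\<dots> \<doteq> (C * B) * (A * C)"
    by (rule cong_mult_right) (rule cong_sym[OF assms(4)])
  also have "\<dots> = C * (const (inverse c) * (const c * (B * A))) * C"
    using assms(2) by (simp add: const_const_mult mult.assoc)
  also have "\<dots> \<doteq> C * (const (inverse c) * (A * B)) * C"
    by (intro cong_mult_left cong_mult_right) (rule cong_sym[OF assms(1)])
  also have "\<dots> = const (inverse c) * (C * A) * (B * C)"
    by (simp add: const_left_commute[of C] mult.assoc)
  also have "\<dots> \<doteq> const (inverse c) * (C * A) * 1"
    by (rule cong_mult_left) (rule assms(3))
  finally show ?thesis by simp
qed

lemma q_commute_power:
  assumes "A * B \<doteq> const c * (B * A)"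
  shows "A * B ^ n \<doteq> const (c ^ n) * (B ^ n * A)"
proof (induction n)
  case (Suc n)
  have "A * B ^ Suc n = (A * B) * B ^ n" by (simp add: mult.assoc)
  also have "\<dots> \<doteq> const c * (B * A) * B ^ n"
    by (rule cong_mult_right) (rule assms)
  also have "\<dots> = const c * B * (A * B ^ n)" by (simp add: mult.assoc)
  also have "\<dots> \<doteq> const c * B * (const (c ^ n) * (B ^ n * A))"
    by (rule cong_mult_left) (rule Suc.IH)
  also have "\<dots> = const (c ^ Suc n) * (B ^ Suc n * A)"
    by (simp add: mult.assoc const_left_commute[of B] const_const_mult)
  finally show ?case .
qed simp

lemma E_Kinv: "E * Kinv \<doteq> const (q\<^sup>2) * (Kinv * E)"
  using q_commute_inverse[OF E_K _ K_Kinv Kinv_K] q_nonzero by simp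

lemma F_Kinv: "F * Kinv \<doteq> const (inverse (q\<^sup>2)) * (Kinv * F)"
  using q_commute_inverse[OF F_K _ K_Kinv Kinv_K] q_nonzero by simp

definition Kpow :: "int \<Rightarrow> generator free_algebra" where
  "Kpow j = (if j \<ge> 0 then K ^ nat j else Kinv ^ nat (- j))"

lemma Kpow_0 [simp]: "Kpow 0 = 1"
  by (simp add: Kpow_def)

lemma Kpow_of_nat: "Kpow (int n) = K ^ n" and Kpow_minus_of_nat: "Kpow (- int n) = Kinv ^ n"
  by (auto simp: Kpow_def)

lemma K_Kpow: "K * Kpow j \<doteq> Kpow (j + 1)"
proof (cases "j \<ge> 0")
  case True
  then show ?thesis by (simp add: Kpow_def nat_add_distrib)
next
  case False
  then obtain n where j: "j = - int (Suc n)"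
    by (metis not_le negD)
  have "K * Kpow j = (K * Kinv) * Kinv ^ n"
    unfolding j Kpow_minus_of_nat by (simp add: mult.assoc)
  also have "\<dots> \<doteq> 1 * Kinv ^ n"
    by (rule cong_mult_right) (rule K_Kinv)
  also have "\<dots> = Kpow (j + 1)"
    using Kpow_minus_of_nat[of n] by (simp add: j)
  finally show ?thesis .
qed

lemma Kinv_Kpow: "Kinv * Kpow j \<doteq> Kpow (j - 1)"
proof (cases "j > 0")
  case False
  then have "nat (1 - j) = Suc (nat (- j))" by simp
  with False show ?thesis by (auto simp: Kpow_def)
next
  case True
  then obtain n where j: "j = int (Suc n)"
    by (metis gr0_conv_Suc pos_int_cases)
  have "Kinv * Kpow j = (Kinv * K) * K ^ n"
    unfolding j Kpow_of_nat by (simp add: mult.assoc)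
  also have "\<dots> \<doteq> 1 * K ^ n"
    by (rule cong_mult_right) (rule Kinv_K)
  also have "\<dots> = Kpow (j - 1)"
    using Kpow_of_nat[of n] by (simp add: j)
  finally show ?thesis .
qed

lemma E_Kpow: "E * Kpow j \<doteq> const ((q\<^sup>2) powi (- j)) * (Kpow j * E)"
  using q_commute_power[OF E_K, of "nat j"] q_commute_power[OF E_Kinv, of "nat (- j)"]
  by (cases "j \<ge> 0") (auto simp: Kpow_def power_int_def)

lemma Kpow_inverse: "Kpow (- j) * Kpow j \<doteq> 1"
proof -
  have *: "A ^ n * B ^ n \<doteq> 1" if "A * B \<doteq> 1" for A B n
  proof (induction n)
    case (Suc n)
    have "A ^ Suc n * B ^ Suc n = A ^ n * (A * B) * B ^ n"
      by (simp only: power_Suc2 power_Suc mult.assoc) (simp add: power_commutes flip: mult.assoc)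
    also have "\<dots> \<doteq> A ^ n * 1 * B ^ n"
      by (intro cong_mult_left cong_mult_right that)
    also have "\<dots> \<doteq> 1" using Suc by simp
    finally show ?case .
  qed simp
  show ?thesis
    using *[OF K_Kinv, of "nat (- j)"] *[OF Kinv_K, of "nat j"]
    by (cases "j \<ge> 0"; cases "j = 0") (auto simp: Kpow_def)
qed


section \<open>The Casimir element and the weight-zero subalgebra\<close>

text \<open>
  The coefficients of \<open>c(K) = cas_pos K\<^sup>m + cas_neg K\<^sup>-\<^sup>m\<close> solve \<open>c(K) - c(q\<^sup>-\<^sup>2K) = f\<^sub>m(K)\<close>.
  For \<open>m = 0\<close> the denominators vanish, and the convention \<open>x / 0 = 0\<close> gives \<open>c = 0\<close>, which is right
  because \<open>f\<^sub>0 = 0\<close>.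
\<close>
definition cas_pos :: complex where
  "cas_pos = inverse (q - inverse q) / (1 - inverse (q\<^sup>2) ^ m)"

definition cas_neg :: complex where
  "cas_neg = - inverse (q - inverse q) / (1 - (q\<^sup>2) ^ m)"

definition cas_K :: "generator free_algebra" where
  "cas_K = const cas_pos * K ^ m + const cas_neg * Kinv ^ m"

text \<open>This is \<open>c(q\<^sup>-\<^sup>2K)\<close>, the element that results from moving \<open>c(K)\<close> to the left past \<open>E\<close>.\<close>
definition cas_K_shift :: "generator free_algebra" where
  "cas_K_shift = const (cas_pos * inverse (q\<^sup>2) ^ m) * K ^ m + const (cas_neg * (q\<^sup>2) ^ m) * Kinv ^ m"

definition Casimir :: "generator free_algebra" where
  "Casimir = F * E + cas_K"

lemma cas_coefficients:
  assumes "m \<noteq> 0"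
  shows "cas_pos = cas_pos * inverse (q\<^sup>2) ^ m + inverse (q - inverse q)"
    and "cas_neg = cas_neg * (q\<^sup>2) ^ m - inverse (q - inverse q)"
proof -
  have "(q\<^sup>2) ^ m \<noteq> 1" "inverse (q\<^sup>2) ^ m \<noteq> 1"
    using assms not_root_of_unity[of "2 * m"] by (simp_all add: power_mult power_inverse)
  then have "cas_pos - cas_pos * inverse (q\<^sup>2) ^ m = inverse (q - inverse q)"
    and "cas_neg - cas_neg * (q\<^sup>2) ^ m = - inverse (q - inverse q)"
    by (simp_all add: cas_pos_def cas_neg_def divide_simps)
  then show "cas_pos = cas_pos * inverse (q\<^sup>2) ^ m + inverse (q - inverse q)"
    and "cas_neg = cas_neg * (q\<^sup>2) ^ m - inverse (q - inverse q)"
    by (simp_all add: algebra_simps)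
qed

lemma cas_K_difference:
  "cas_K = cas_K_shift + const (inverse (q - inverse q)) * (K ^ m - Kinv ^ m)"
proof (cases "m = 0")
  case True
  then show ?thesis
    unfolding cas_K_def cas_K_shift_def by simp
next
  case False
  then have "const cas_pos = const (cas_pos * inverse (q\<^sup>2) ^ m) + const (inverse (q - inverse q))"
    and "const cas_neg = const (cas_neg * (q\<^sup>2) ^ m) - const (inverse (q - inverse q))"
    by (metis cas_coefficients(1) const_add, metis cas_coefficients(2) const_diff)
  then show ?thesis
    unfolding cas_K_def cas_K_shift_def
    by (subst \<open>const cas_pos = _\<close>, subst \<open>const cas_neg = _\<close>) (simp add: distrib_right left_diff_distrib right_diff_distrib)
qed

lemma F_mult_E: "F * E = Casimir - cas_K"
  by (simp add: Casimir_def)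

lemma E_mult_F: "E * F \<doteq> Casimir - cas_K_shift"
proof -
  have "Casimir - cas_K_shift = F * E + const (inverse (q - inverse q)) * (K ^ m - Kinv ^ m)"
    by (simp add: Casimir_def cas_K_difference)
  then show ?thesis using E_F by simp
qed

lemma E_cas_K: "E * cas_K \<doteq> cas_K_shift * E"
proof -
  have "E * cas_K = const cas_pos * (E * K ^ m) + const cas_neg * (E * Kinv ^ m)"
    by (simp add: cas_K_def distrib_left const_left_commute[of E])
  also have "\<dots> \<doteq> const cas_pos * (const (inverse (q\<^sup>2) ^ m) * (K ^ m * E))
      + const cas_neg * (const ((q\<^sup>2) ^ m) * (Kinv ^ m * E))"
    by (intro cong_add cong_mult_left q_commute_power E_K E_Kinv)
  also have "\<dots> = cas_K_shift * E"
    by (simp add: cas_K_shift_def distrib_right const_mult mult.assoc)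
  finally show ?thesis .
qed

lemma F_cas_K_shift: "F * cas_K_shift \<doteq> cas_K * F"
proof -
  have "F * cas_K_shift = const (cas_pos * inverse (q\<^sup>2) ^ m) * (F * K ^ m)
      + const (cas_neg * (q\<^sup>2) ^ m) * (F * Kinv ^ m)"
    by (simp add: cas_K_shift_def distrib_left const_left_commute[of F])
  also have "\<dots> \<doteq> const (cas_pos * inverse (q\<^sup>2) ^ m) * (const ((q\<^sup>2) ^ m) * (K ^ m * F))
      + const (cas_neg * (q\<^sup>2) ^ m) * (const (inverse (q\<^sup>2) ^ m) * (Kinv ^ m * F))"
    by (intro cong_add cong_mult_left q_commute_power F_K F_Kinv)
  also have "\<dots> = cas_K * F"
    using q_nonzero
    by (simp add: cas_K_def distrib_right const_const_mult mult.assoc power_inverse field_simps)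
  finally show ?thesis .
qed

lemma cong_diff: "a \<doteq> a' \<Longrightarrow> b \<doteq> b' \<Longrightarrow> a - b \<doteq> a' - b'"
  using U_ideal_diff[of "a - a'" q m "b - b'"] by (simp add: cong_def algebra_simps)

lemma E_Casimir: "E * Casimir \<doteq> Casimir * E"
proof -
  have "E * Casimir = (E * F) * E + E * cas_K"
    by (simp add: Casimir_def distrib_left mult.assoc)
  also have "\<dots> \<doteq> (Casimir - cas_K_shift) * E + cas_K_shift * E"
    by (intro cong_add cong_mult_right E_mult_F E_cas_K)
  also have "\<dots> = Casimir * E"
    by (simp add: left_diff_distrib)
  finally show ?thesis .
qed

lemma F_Casimir: "F * Casimir \<doteq> Casimir * F"
proof -
  have "F * Casimir = F * (Casimir - cas_K_shift) + F * cas_K_shift"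
    by (simp add: right_diff_distrib)
  also have "\<dots> \<doteq> F * (E * F) + cas_K * F"
    by (intro cong_add cong_mult_left cong_sym[OF E_mult_F] F_cas_K_shift)
  also have "\<dots> = Casimir * F"
    by (simp add: Casimir_def distrib_right mult.assoc)
  finally show ?thesis .
qed

lemma commute_add: "a * b \<doteq> b * a \<Longrightarrow> a * c \<doteq> c * a \<Longrightarrow> a * (b + c) \<doteq> (b + c) * a"
  by (simp add: distrib_left distrib_right cong_add)

lemma commute_mult:
  assumes "a * b \<doteq> b * a" "a * c \<doteq> c * a"
  shows "a * (b * c) \<doteq> (b * c) * a"
proof -
  have "a * (b * c) = (a * b) * c" by (simp add: mult.assoc)
  also have "\<dots> \<doteq> (b * a) * c" by (rule cong_mult_right) (rule assms)
  also have "\<dots> = b * (a * c)" by (simp add: mult.assoc)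
  also have "\<dots> \<doteq> b * (c * a)" by (rule cong_mult_left) (rule assms)
  finally show ?thesis by (simp add: mult.assoc)
qed

lemma commute_const: "a * const c \<doteq> const c * a"
  by (simp add: const_commute)

lemma commute_power: "a * b \<doteq> b * a \<Longrightarrow> a * b ^ n \<doteq> b ^ n * a"
  by (induction n) (auto intro: commute_mult)

lemma K_commute_Kinv: "K * Kinv \<doteq> Kinv * K"
  using cong_trans[OF K_Kinv cong_sym[OF Kinv_K]] .

lemma K_Casimir: "K * Casimir \<doteq> Casimir * K"
proof -
  have "K * (F * E) = (K * F) * E" by (simp add: mult.assoc)
  also have "\<dots> \<doteq> const (inverse (q\<^sup>2)) * (F * K) * E"
    by (intro cong_mult_right K_F)
  also have "\<dots> = const (inverse (q\<^sup>2)) * F * (K * E)" by (simp add: mult.assoc)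
  also have "\<dots> \<doteq> const (inverse (q\<^sup>2)) * F * (const (q\<^sup>2) * (E * K))"
    by (intro cong_mult_left K_E)
  also have "\<dots> = (F * E) * K"
    using q_nonzero by (simp add: mult.assoc const_left_commute[of F] const_const_mult)
  finally show ?thesis
    unfolding Casimir_def cas_K_def
    by (rule commute_add)
       (intro commute_add commute_mult commute_const commute_power K_commute_Kinv cong_refl)
qed

lemma Kinv_Casimir: "Kinv * Casimir \<doteq> Casimir * Kinv"
  using q_commute_inverse[of Casimir K 1 Kinv, OF _ _ K_Kinv Kinv_K] cong_sym[OF K_Casimir]
  by (auto intro: cong_sym)

lemma Casimir_central: "a * Casimir \<doteq> Casimir * a"
proof (induction a rule: free_algebra_induct)
  case (add a b)
  then show ?case by (simp add: distrib_left distrib_right cong_add)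
next
  case (const_mult c a)
  then show ?case
    by (simp add: const_left_commute[of Casimir] mult.assoc cong_mult_left)
next
  case (gen_mult x a)
  have "gen x * Casimir \<doteq> Casimir * gen x"
    using E_Casimir F_Casimir K_Casimir Kinv_Casimir by (cases x) auto
  then show ?case
    using gen_mult by (intro cong_sym[OF commute_mult]) (auto intro: cong_sym)
qed simp

text \<open>
  The value \<open>p(\<Omega>)\<close>, by a Horner scheme, since polynomial evaluation is confined to commutative rings.
\<close>
definition cas_poly :: "complex poly \<Rightarrow> generator free_algebra" where
  "cas_poly p = fold_coeffs (\<lambda>c a. const c + Casimir * a) p 0"

lemma cas_poly_0 [simp]: "cas_poly 0 = 0"
  by (simp add: cas_poly_def)

lemma cas_poly_pCons [simp]: "cas_poly (pCons c p) = const c + Casimir * cas_poly p"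
proof (cases "c = 0 \<and> p = 0")
  case False
  then have "c \<noteq> 0 \<or> p \<noteq> 0" by simp
  then show ?thesis by (auto simp: cas_poly_def fold_coeffs_pCons_not_0_0_eq fold_coeffs_pCons_coeff_not_0_eq)
qed simp

lemma cas_poly_1 [simp]: "cas_poly 1 = 1"
  by (simp add: one_pCons)

lemma cas_poly_add: "cas_poly (p + p') = cas_poly p + cas_poly p'"
  by (induction p p' rule: poly_induct2) (simp_all add: const_add distrib_left)

lemma cas_poly_smult: "cas_poly (smult c p) = const c * cas_poly p"
  by (induction p) (simp_all add: const_mult distrib_left const_left_commute[of Casimir])

lemma cas_poly_central: "a * cas_poly p \<doteq> cas_poly p * a"
  by (induction p) (auto intro!: commute_add commute_mult commute_const Casimir_central)

text \<open>
  The representatives of elements of the subalgebra of \<open>U\<close> generated by \<open>K\<close>, \<open>K\<^sup>-\<^sup>1\<close> and \<open>\<Omega>\<close>, which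
  \<open>commutes_with_K_imp_weight0\<close> identifies as the centralizer of \<open>K\<close>.  Closure
  under left multiplication by generators suffices as a definition and makes inductions short.
\<close>
inductive_set weight0 :: "generator free_algebra set" where
  weight0_ideal: "a \<in> U_ideal q m \<Longrightarrow> a \<in> weight0"
| weight0_one: "1 \<in> weight0"
| weight0_add: "a \<in> weight0 \<Longrightarrow> b \<in> weight0 \<Longrightarrow> a + b \<in> weight0"
| weight0_const: "a \<in> weight0 \<Longrightarrow> const c * a \<in> weight0"
| weight0_K: "a \<in> weight0 \<Longrightarrow> K * a \<in> weight0"
| weight0_Kinv: "a \<in> weight0 \<Longrightarrow> Kinv * a \<in> weight0"
| weight0_Casimir: "a \<in> weight0 \<Longrightarrow> Casimir * a \<in> weight0"

lemma weight0_cong: "a \<in> weight0 \<Longrightarrow> b \<doteq> a \<Longrightarrow> b \<in> weight0"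
  using weight0_add[of a "b - a"] weight0_ideal[of "b - a"] by (simp add: cong_def)

lemma weight0_diff: "a \<in> weight0 \<Longrightarrow> b \<in> weight0 \<Longrightarrow> a - b \<in> weight0"
  using weight0_add[of a "const (-1) * b"] weight0_const[of b "-1"] by (simp add: const_uminus)

lemma weight0_sum: "(\<And>i. i \<in> S \<Longrightarrow> f i \<in> weight0) \<Longrightarrow> sum f S \<in> weight0"
  by (induction S rule: infinite_finite_induct) (auto intro: weight0.intros U_ideal_0)

lemma weight0_mult: "a \<in> weight0 \<Longrightarrow> b \<in> weight0 \<Longrightarrow> a * b \<in> weight0"
  by (induction rule: weight0.induct)
     (auto intro: weight0.intros U_ideal_mult_right simp: distrib_right mult.assoc)

lemma weight0_gens: "K \<in> weight0" "Kinv \<in> weight0" "Casimir \<in> weight0" "const c \<in> weight0"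
  using weight0_K[OF weight0_one] weight0_Kinv[OF weight0_one] weight0_Casimir[OF weight0_one] weight0_const[OF weight0_one]
  by simp_all

lemma weight0_power: "a \<in> weight0 \<Longrightarrow> a ^ n \<in> weight0"
  by (induction n) (auto intro: weight0_one weight0_mult)

lemma cas_K_in_weight0: "cas_K \<in> weight0" and cas_K_shift_in_weight0: "cas_K_shift \<in> weight0"
  unfolding cas_K_def cas_K_shift_def
  by (intro weight0_add weight0_mult weight0_power weight0_gens)+

text \<open>
  The subalgebra is stable under the automorphism \<open>K \<mapsto> c K\<close>, \<open>\<Omega> \<mapsto> \<Omega>\<close>, which is what moving \<open>E\<close> or \<open>F\<close>
  past it produces.
\<close>
lemma weight0_push:
  assumes "A * K \<doteq> const c * (K * A)" "A * Kinv \<doteq> const d * (Kinv * A)" "a \<in> weight0"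
  shows "\<exists>b\<in>weight0. A * a \<doteq> b * A"
  using assms(3)
proof (induction rule: weight0.induct)
  case (weight0_ideal a)
  then have "A * a \<doteq> 0 * A" by (simp add: cong_0_iff U_ideal_mult_left)
  then show ?case using U_ideal_0 weight0.weight0_ideal by blast
next
  case weight0_one
  show ?case by (rule bexI[of _ 1]) (auto intro: weight0.intros)
next
  case (weight0_add a a')
  then obtain b b' where "b \<in> weight0" "b' \<in> weight0" "A * a \<doteq> b * A" "A * a' \<doteq> b' * A" by blast
  then show ?case
    by (intro bexI[of _ "b + b'"]) (auto simp: distrib_left distrib_right intro: weight0.intros cong_add)
next
  case (weight0_const a e)
  then obtain b where "b \<in> weight0" "A * a \<doteq> b * A" by blast
  then show ?case
    by (intro bexI[of _ "const e * b"])
       (auto simp: const_left_commute[of A] mult.assoc intro: weight0.intros cong_mult_left)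
next
  case (weight0_K a)
  then obtain b where b: "b \<in> weight0" "A * a \<doteq> b * A" by blast
  have "A * (K * a) = (A * K) * a" by (simp add: mult.assoc)
  also have "\<dots> \<doteq> const c * (K * A) * a" by (intro cong_mult_right assms)
  also have "\<dots> = const c * K * (A * a)" by (simp add: mult.assoc)
  also have "\<dots> \<doteq> const c * K * (b * A)" by (intro cong_mult_left b)
  finally show ?case
    using b by (intro bexI[of _ "const c * (K * b)"]) (auto simp: mult.assoc intro: weight0.intros)
next
  case (weight0_Kinv a)
  then obtain b where b: "b \<in> weight0" "A * a \<doteq> b * A" by blast
  have "A * (Kinv * a) = (A * Kinv) * a" by (simp add: mult.assoc)
  also have "\<dots> \<doteq> const d * (Kinv * A) * a" by (intro cong_mult_right assms)
  also have "\<dots> = const d * Kinv * (A * a)" by (simp add: mult.assoc)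
  also have "\<dots> \<doteq> const d * Kinv * (b * A)" by (intro cong_mult_left b)
  finally show ?case
    using b by (intro bexI[of _ "const d * (Kinv * b)"]) (auto simp: mult.assoc intro: weight0.intros)
next
  case (weight0_Casimir a)
  then obtain b where b: "b \<in> weight0" "A * a \<doteq> b * A" by blast
  have "A * (Casimir * a) = (A * Casimir) * a" by (simp add: mult.assoc)
  also have "\<dots> \<doteq> (Casimir * A) * a" by (intro cong_mult_right Casimir_central)
  also have "\<dots> = Casimir * (A * a)" by (simp add: mult.assoc)
  also have "\<dots> \<doteq> Casimir * (b * A)" by (intro cong_mult_left b)
  finally show ?case
    using b by (intro bexI[of _ "Casimir * b"]) (auto simp: mult.assoc intro: weight0.intros)
qed

lemmas E_weight0 = weight0_push[OF E_K E_Kinv]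
lemmas F_weight0 = weight0_push[OF F_K F_Kinv]

definition laurent :: "int set \<Rightarrow> (int \<Rightarrow> complex poly) \<Rightarrow> generator free_algebra" where
  "laurent S p = (\<Sum>j\<in>S. Kpow j * cas_poly (p j))"

lemma laurent_add:
  assumes "finite S" "finite T"
  shows "laurent S p + laurent T r =
    laurent (S \<union> T) (\<lambda>j. (if j \<in> S then p j else 0) + (if j \<in> T then r j else 0))"
proof -
  have "laurent S p = (\<Sum>j\<in>S \<union> T. Kpow j * cas_poly (if j \<in> S then p j else 0))"
    unfolding laurent_def using assms by (intro sum.mono_neutral_cong_left) auto
  moreover have "laurent T r = (\<Sum>j\<in>S \<union> T. Kpow j * cas_poly (if j \<in> T then r j else 0))"
    unfolding laurent_def using assms by (intro sum.mono_neutral_cong_left) auto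
  ultimately show ?thesis
    unfolding laurent_def by (simp only: cas_poly_add distrib_left sum.distrib)
qed

lemma laurent_const: "const c * laurent S p = laurent S (\<lambda>j. smult c (p j))"
proof -
  have "const c * (Kpow j * a) = Kpow j * (const c * a)" for j a
    by (simp add: const_left_commute[of "Kpow j"])
  then show ?thesis
    by (simp add: laurent_def sum_distrib_left cas_poly_smult)
qed

lemma laurent_shift:
  assumes "\<And>j. A * Kpow j \<doteq> Kpow (j + d)"
  shows "A * laurent S p \<doteq> laurent ((\<lambda>j. j + d) ` S) (\<lambda>j. p (j - d))"
proof -
  have "A * laurent S p = (\<Sum>j\<in>S. (A * Kpow j) * cas_poly (p j))"
    by (simp add: laurent_def sum_distrib_left mult.assoc)
  also have "\<dots> \<doteq> (\<Sum>j\<in>S. Kpow (j + d) * cas_poly (p j))"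
    by (intro cong_sum cong_mult_right assms)
  also have "\<dots> = laurent ((\<lambda>j. j + d) ` S) (\<lambda>j. p (j - d))"
    unfolding laurent_def by (subst sum.reindex) (auto simp: inj_on_def)
  finally show ?thesis .
qed

lemma laurent_Casimir: "Casimir * laurent S p \<doteq> laurent S (\<lambda>j. pCons 0 (p j))"
proof -
  have "Casimir * laurent S p = (\<Sum>j\<in>S. (Casimir * Kpow j) * cas_poly (p j))"
    by (simp add: laurent_def sum_distrib_left mult.assoc)
  also have "\<dots> \<doteq> (\<Sum>j\<in>S. (Kpow j * Casimir) * cas_poly (p j))"
    by (intro cong_sum cong_mult_right cong_sym[OF Casimir_central])
  finally show ?thesis
    by (simp add: laurent_def mult.assoc)
qed

text \<open>
  A normal form.  It is unique up to zero coefficients, which \<open>rep_laurent\<close> shows by recovering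
  the coefficients from the action on the universal Whittaker module.
\<close>
lemma weight0_laurent: "a \<in> weight0 \<Longrightarrow> \<exists>S p. finite S \<and> a \<doteq> laurent S p"
proof (induction rule: weight0.induct)
  case (weight0_ideal a)
  then have "a \<doteq> laurent {} (\<lambda>_. 0)" by (simp add: laurent_def cong_0_iff)
  then show ?case by blast
next
  case weight0_one
  have "1 \<doteq> laurent {0} (\<lambda>_. 1)" by (simp add: laurent_def)
  then show ?case by blast
next
  case (weight0_add a b)
  from weight0_add.IH(1) obtain S p where S: "finite S" "a \<doteq> laurent S p" by blast
  from weight0_add.IH(2) obtain T r where T: "finite T" "b \<doteq> laurent T r" by blast
  have "a + b \<doteq> laurent (S \<union> T) (\<lambda>j. (if j \<in> S then p j else 0) + (if j \<in> T then r j else 0))"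
    using cong_add[OF S(2) T(2)] by (simp only: laurent_add[OF S(1) T(1)])
  then show ?case using S(1) T(1) by (blast intro: finite_UnI)
next
  case (weight0_const a c)
  then obtain S p where S: "finite S" "a \<doteq> laurent S p" by blast
  have "const c * a \<doteq> laurent S (\<lambda>j. smult c (p j))"
    using cong_mult_left[OF S(2), of "const c"] by (simp only: laurent_const)
  with S(1) show ?case by blast
next
  case (weight0_K a)
  then obtain S p where S: "finite S" "a \<doteq> laurent S p" by blast
  from cong_trans[OF cong_mult_left[OF S(2)] laurent_shift[OF K_Kpow]] finite_imageI[OF S(1)]
  show ?case by blast
next
  case (weight0_Kinv a)
  then obtain S p where S: "finite S" "a \<doteq> laurent S p" by blast
  have "Kinv * Kpow j \<doteq> Kpow (j + (-1))" for j
    using Kinv_Kpow[of j] by simp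
  from cong_trans[OF cong_mult_left[OF S(2)] laurent_shift[OF this]] finite_imageI[OF S(1)]
  show ?case by blast
next
  case (weight0_Casimir a)
  then obtain S p where S: "finite S" "a \<doteq> laurent S p" by blast
  from cong_trans[OF cong_mult_left[OF S(2)] laurent_Casimir] S(1)
  show ?case by blast
qed

section \<open>The weight grading\<close>

primrec gen_weight :: "generator \<Rightarrow> int" where
  "gen_weight GE = 1"
| "gen_weight GF = -1"
| "gen_weight GK = 0"
| "gen_weight GKinv = 0"

definition word_weight :: "generator free_monoid \<Rightarrow> int" where
  "word_weight w = (\<Sum>x\<leftarrow>letters w. gen_weight x)"

definition weight_component :: "int \<Rightarrow> generator free_algebra \<Rightarrow> generator free_algebra" where
  "weight_component d a =
    (\<Sum>w\<in>{w \<in> Poly_Mapping.keys a. word_weight w = d}. Poly_Mapping.single w (Poly_Mapping.lookup a w))"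

text \<open>A generator of the part of weight \<open>d\<close> as a left module over the part of weight zero.\<close>
definition EFpow :: "int \<Rightarrow> generator free_algebra" where
  "EFpow d = (if d \<ge> 0 then E ^ nat d else F ^ nat (- d))"

lemma E_EFpow: "\<exists>b\<in>weight0. E * EFpow d \<doteq> b * EFpow (d + 1)"
proof (cases "d \<ge> 0")
  case True
  then have "E * EFpow d = 1 * EFpow (d + 1)"
    by (simp add: EFpow_def nat_add_distrib)
  then show ?thesis using weight0_one by (metis cong_refl)
next
  case False
  then obtain n where d: "d = - int (Suc n)"
    by (metis not_le negD)
  have "E * EFpow d = (E * F) * EFpow (d + 1)"
    by (simp add: d EFpow_def mult.assoc nat_add_distrib)
  also have "\<dots> \<doteq> (Casimir - cas_K_shift) * EFpow (d + 1)"
    by (intro cong_mult_right E_mult_F)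
  finally show ?thesis
    using weight0_diff[OF weight0_gens(3) cas_K_shift_in_weight0] by blast
qed

lemma F_EFpow: "\<exists>b\<in>weight0. F * EFpow d \<doteq> b * EFpow (d - 1)"
proof (cases "d > 0")
  case False
  then have "nat (1 - d) = Suc (nat (- d))" by simp
  with False have "F * EFpow d = 1 * EFpow (d - 1)"
    by (cases "d = 0") (simp_all add: EFpow_def)
  then show ?thesis using weight0_one by (metis cong_refl)
next
  case True
  then obtain n where d: "d = int (Suc n)"
    by (metis gr0_conv_Suc pos_int_cases)
  have "F * EFpow d = (F * E) * EFpow (d - 1)"
    by (simp add: d EFpow_def mult.assoc nat_add_distrib)
  also have "\<dots> = (Casimir - cas_K) * EFpow (d - 1)"
    by (simp add: F_mult_E)
  finally show ?thesis
    using weight0_diff[OF weight0_gens(3) cas_K_in_weight0] by (metis cong_refl)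
qed

lemma gen_weight0_EFpow:
  assumes "a \<in> weight0"
  shows "\<exists>b\<in>weight0. gen x * (a * EFpow d) \<doteq> b * EFpow (gen_weight x + d)"
proof -
  have *: "\<exists>b\<in>weight0. A * (a * EFpow d) \<doteq> b * EFpow d'"
    if "\<exists>b\<in>weight0. A * a \<doteq> b * A" "\<exists>b\<in>weight0. A * EFpow d \<doteq> b * EFpow d'" for A d'
  proof -
    obtain b c where b: "b \<in> weight0" "A * a \<doteq> b * A" and c: "c \<in> weight0" "A * EFpow d \<doteq> c * EFpow d'"
      using \<open>\<exists>b\<in>weight0. A * a \<doteq> b * A\<close> \<open>\<exists>b\<in>weight0. A * EFpow d \<doteq> b * EFpow d'\<close> by blast
    have "A * (a * EFpow d) = (A * a) * EFpow d" by (simp add: mult.assoc)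
    also have "\<dots> \<doteq> b * A * EFpow d" by (intro cong_mult_right b)
    also have "\<dots> = b * (A * EFpow d)" by (simp add: mult.assoc)
    also have "\<dots> \<doteq> b * (c * EFpow d')" by (intro cong_mult_left c)
    finally show ?thesis
      using weight0_mult[OF b(1) c(1)] by (metis mult.assoc)
  qed
  show ?thesis
  proof (cases x)
    case GE
    then show ?thesis using *[OF E_weight0[OF assms] E_EFpow] by (simp add: add.commute)
  next
    case GF
    then show ?thesis using *[OF F_weight0[OF assms] F_EFpow] by simp
  next
    case GK
    then show ?thesis using weight0_K[OF assms]
      by (intro bexI[of _ "K * a"]) (simp_all add: mult.assoc)
  next
    case GKinv
    then show ?thesis using weight0_Kinv[OF assms]
      by (intro bexI[of _ "Kinv * a"]) (simp_all add: mult.assoc)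
  qed
qed

text \<open>
  A word is brought to the form \<open>b E\<^sup>d\<close> or \<open>b F\<^sup>-\<^sup>d\<close> letter by letter.  A letter that meets a power of the
  opposite generator cancels against it, because \<open>EF\<close> and \<open>FE\<close> have weight zero.
\<close>
lemma single_weight0_EFpow:
  "\<exists>b\<in>weight0. Poly_Mapping.single w c \<doteq> b * EFpow (word_weight w)"
proof -
  obtain xs where w: "w = Word xs" by (cases w)
  have "\<exists>b\<in>weight0. Poly_Mapping.single (Word xs) c \<doteq> b * EFpow (word_weight (Word xs))"
  proof (induction xs)
    case Nil
    then show ?case using weight0_gens(4)[of c]
      by (intro bexI[of _ "const c"]) (simp_all add: single_Nil EFpow_def word_weight_def)
  next
    case (Cons x xs)
    then obtain b where b: "b \<in> weight0"
      "Poly_Mapping.single (Word xs) c \<doteq> b * EFpow (word_weight (Word xs))" by blast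
    have "Poly_Mapping.single (Word (x # xs)) c \<doteq> gen x * (b * EFpow (word_weight (Word xs)))"
      unfolding gen_mult_single[symmetric] by (intro cong_mult_left b)
    with gen_weight0_EFpow[OF b(1), of x "word_weight (Word xs)"] show ?case
      by (auto simp: word_weight_def intro: cong_trans)
  qed
  then show ?thesis by (simp add: w)
qed

lemma weight_component_0: "weight_component 0 a \<in> weight0"
  unfolding weight_component_def
proof (rule weight0_sum)
  fix w assume "w \<in> {w \<in> Poly_Mapping.keys a. word_weight w = 0}"
  then show "Poly_Mapping.single w (Poly_Mapping.lookup a w) \<in> weight0"
    using single_weight0_EFpow[of w "Poly_Mapping.lookup a w"] by (auto simp: EFpow_def intro: weight0_cong)
qed

lemma sum_weight_component:
  "a = (\<Sum>d\<in>word_weight ` Poly_Mapping.keys a. weight_component d a)"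
  unfolding weight_component_def
  by (subst sum.image_gen[symmetric]) (auto simp flip: poly_mapping_eq_sum_single)

lemma K_gen: "K * gen x \<doteq> const ((q\<^sup>2) powi gen_weight x) * (gen x * K)"
  using K_E K_F K_commute_Kinv by (cases x) (auto simp: power_int_minus)

lemma K_single:
  "K * Poly_Mapping.single w c \<doteq> const ((q\<^sup>2) powi word_weight w) * (Poly_Mapping.single w c * K)"
proof -
  obtain xs where w: "w = Word xs" by (cases w)
  have "K * Poly_Mapping.single (Word xs) c
    \<doteq> const ((q\<^sup>2) powi word_weight (Word xs)) * (Poly_Mapping.single (Word xs) c * K)"
  proof (induction xs)
    case Nil
    then show ?case by (simp add: single_Nil word_weight_def const_commute)
  next
    case (Cons x xs)
    let ?s = "Poly_Mapping.single (Word xs) c" and ?d = "word_weight (Word xs)"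
    have "K * Poly_Mapping.single (Word (x # xs)) c = (K * gen x) * ?s"
      by (simp add: gen_mult_single[symmetric] mult.assoc)
    also have "\<dots> \<doteq> const ((q\<^sup>2) powi gen_weight x) * (gen x * K) * ?s"
      by (intro cong_mult_right K_gen)
    also have "\<dots> = const ((q\<^sup>2) powi gen_weight x) * gen x * (K * ?s)"
      by (simp add: mult.assoc)
    also have "\<dots> \<doteq> const ((q\<^sup>2) powi gen_weight x) * gen x * (const ((q\<^sup>2) powi ?d) * (?s * K))"
      by (intro cong_mult_left Cons.IH)
    also have "\<dots> = const ((q\<^sup>2) powi (gen_weight x + ?d)) * (gen x * ?s * K)"
      using q_nonzero
      by (simp add: mult.assoc const_left_commute[of "gen x"] const_const_mult power_int_add)
    finally show ?case
      by (simp add: gen_mult_single word_weight_def)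
  qed
  then show ?thesis by (simp add: w)
qed

lemma K_weight_component:
  "K * weight_component d a \<doteq> const ((q\<^sup>2) powi d) * (weight_component d a * K)"
  unfolding weight_component_def sum_distrib_left sum_distrib_right
  by (rule cong_sum) (use K_single in auto)

text \<open>
  The weight components of \<open>z\<close> are eigenvectors of conjugation by \<open>K\<close> with the distinct eigenvalues
  \<open>q\<^sup>2\<^sup>d\<close>, so if conjugation fixes \<open>z\<close>, only the component of weight zero survives.
\<close>
lemma commutes_with_K_imp_weight0:
  assumes "K * z \<doteq> z * K"
  shows "z \<in> weight0"
proof -
  define D where "D = insert 0 (word_weight ` Poly_Mapping.keys z)"
  have D: "finite D" "0 \<in> D" by (auto simp: D_def)
  have z: "z = (\<Sum>d\<in>D. weight_component d z)"
  proof -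
    have "weight_component d z = 0" if "d \<notin> word_weight ` Poly_Mapping.keys z" for d
      using that by (auto simp: weight_component_def intro!: sum.neutral)
    then show ?thesis
      unfolding D_def by (subst sum_weight_component) (auto intro!: sum.mono_neutral_left)
  qed
  define f where "f d = weight_component d z * K" for d
  have conj: "K * f d * Kinv \<doteq> const ((q\<^sup>2) powi d) * f d" for d
  proof -
    have "K * f d * Kinv = K * weight_component d z * (K * Kinv)" by (simp add: f_def mult.assoc)
    also have "\<dots> \<doteq> K * weight_component d z * 1" by (intro cong_mult_left K_Kinv)
    also have "\<dots> \<doteq> const ((q\<^sup>2) powi d) * f d"
      using K_weight_component by (simp add: f_def)
    finally show ?thesis .
  qed
  have zK: "z * K = sum f D"
    by (subst z) (simp add: f_def sum_distrib_right)
  have Kz: "K * z = (\<Sum>d\<in>D. K * weight_component d z)"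
    by (subst z) (simp add: sum_distrib_left)
  \<comment> \<open>The terms of this sum, which is \<open>K z - z K\<close>, are eigenvectors of conjugation by \<open>K\<close>; so each of
    them vanishes in \<open>U\<close>, and the factor \<open>q\<^sup>2\<^sup>d - 1\<close> is invertible unless \<open>d = 0\<close>.\<close>
  have "(\<Sum>d\<in>D. const ((q\<^sup>2) powi d - 1) * f d) \<doteq> 0"
  proof -
    have "(\<Sum>d\<in>D. const ((q\<^sup>2) powi d - 1) * f d) = (\<Sum>d\<in>D. const ((q\<^sup>2) powi d) * f d) - z * K"
      by (simp add: zK const_diff left_diff_distrib sum_subtractf)
    also have "\<dots> \<doteq> K * z - z * K"
      unfolding Kz using K_weight_component
      by (intro cong_diff cong_sum cong_refl) (auto simp: f_def intro: cong_sym)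
    also have "\<dots> \<doteq> 0"
      using assms by (simp add: cong_def)
    finally show ?thesis .
  qed
  then have sum0: "(\<Sum>d\<in>D. const ((q\<^sup>2) powi d - 1) * f d) \<in> U_ideal q m"
    by (simp add: cong_0_iff)
  have f_ideal: "const ((q\<^sup>2) powi d - 1) * f d \<in> U_ideal q m" if "d \<in> D" for d
  proof (rule eigenvectors_independent[where S = D and i = d
        and T = "\<lambda>a. K * a * Kinv" and \<mu> = "\<lambda>d. (q\<^sup>2) powi d"
        and f = "\<lambda>d. const ((q\<^sup>2) powi d - 1) * f d"])
    show "inj_on (\<lambda>d. (q\<^sup>2) powi d) D"
      by (auto intro: inj_onI q2_powi_inj)
    show "K * (const ((q\<^sup>2) powi i - 1) * f i) * Kinv
        - const ((q\<^sup>2) powi i) * (const ((q\<^sup>2) powi i - 1) * f i) \<in> U_ideal q m" for i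
      using cong_mult_left[OF conj[of i], of "const ((q\<^sup>2) powi i - 1)"]
      by (simp add: cong_def const_left_commute[of K] const_const_mult mult.assoc mult.commute)
    show "K * (const c * a) * Kinv = const c * (K * a * Kinv)" for c a
      by (simp add: const_left_commute[of K] mult.assoc)
  qed (use that D sum0 in \<open>auto intro: U_ideal_add U_ideal_mult_left U_ideal_mult_right
      simp: distrib_left distrib_right\<close>)
  have "weight_component d z \<doteq> 0" if "d \<in> D - {0}" for d
  proof -
    have "const (inverse ((q\<^sup>2) powi d - 1)) * (const ((q\<^sup>2) powi d - 1) * f d) \<in> U_ideal q m"
      using that by (intro U_ideal_mult_left[OF f_ideal]) simp
    then have "f d \<in> U_ideal q m"
      using q2_powi_neq_1[of d] that by (simp add: const_const_mult)
    then have "f d * Kinv \<in> U_ideal q m"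
      by (rule U_ideal_mult_right)
    moreover have "f d * Kinv \<doteq> weight_component d z * 1"
      unfolding f_def mult.assoc by (intro cong_mult_left K_Kinv)
    ultimately show ?thesis
      using cong_trans[of "weight_component d z" "f d * Kinv" 0] cong_sym
      by (simp add: cong_0_iff)
  qed
  then have "(\<Sum>d\<in>D - {0}. weight_component d z) \<doteq> (\<Sum>d\<in>D - {0}. 0)"
    by (intro cong_sum)
  then have "weight_component 0 z + (\<Sum>d\<in>D - {0}. weight_component d z) \<doteq> weight_component 0 z"
    using cong_add[OF cong_refl, of "\<Sum>d\<in>D - {0}. weight_component d z" 0 "weight_component 0 z"]
    by simp
  then have "z \<doteq> weight_component 0 z"
    using D by (subst z) (simp add: sum.remove[of D 0])
  then show ?thesis
    using weight_component_0 weight0_cong by blast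
qed

end


section \<open>The universal Whittaker module\<close>

locale generic_whittaker = generic_U +
  fixes e :: complex
  assumes e_nonzero: "e \<noteq> 0"
begin

definition e_weight :: "int \<Rightarrow> complex" where
  "e_weight j = e * (q\<^sup>2) powi (- j)"

lemma e_weight_nonzero: "e_weight j \<noteq> 0"
  using e_nonzero q_nonzero by (simp add: e_weight_def)

lemma e_weight_inj: "e_weight i = e_weight j \<Longrightarrow> i = j"
  using e_nonzero q2_powi_inj[of "- i" "- j"] by (simp add: e_weight_def)

lemma e_weight_shift:
  "e_weight (j - int k) = (q\<^sup>2) ^ k * e_weight j"
  "e_weight (j + int k) = inverse (q\<^sup>2) ^ k * e_weight j"
  using q_nonzero
  by (simp_all add: e_weight_def power_int_diff power_int_minus power_int_add power_inverse divide_simps)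

text \<open>
  A function \<open>n :: int \<Rightarrow> complex poly\<close> stands for the formal series \<open>\<Sum>\<^sub>j n\<^sub>j(x) t\<^sup>j\<close>.  The generator \<open>K\<close>
  acts as multiplication by \<open>t\<close>, \<open>E\<close> scales \<open>t\<^sup>j\<close> by \<open>e q\<^sup>-\<^sup>2\<^sup>j\<close>, and \<open>F\<close> acts as \<open>(x - c(t)) E\<^sup>-\<^sup>1\<close>,
  which makes \<open>\<Omega>\<close> act as \<open>x\<close>.  Infinite sums do no harm: only the orbit of the vector \<open>1\<close>, which
  consists of Laurent polynomials in \<open>t\<close>, enters the argument.
\<close>
primrec gen_act :: "generator \<Rightarrow> (int \<Rightarrow> complex poly) \<Rightarrow> int \<Rightarrow> complex poly" where
  "gen_act GE n = (\<lambda>j. smult (e_weight j) (n j))"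
| "gen_act GF n = (\<lambda>j. pCons 0 (smult (inverse (e_weight j)) (n j))
     - smult (cas_pos * inverse (e_weight (j - int m))) (n (j - int m))
     - smult (cas_neg * inverse (e_weight (j + int m))) (n (j + int m)))"
| "gen_act GK n = (\<lambda>j. n (j - 1))"
| "gen_act GKinv n = (\<lambda>j. n (j + 1))"

definition word_act :: "generator free_monoid \<Rightarrow> (int \<Rightarrow> complex poly) \<Rightarrow> int \<Rightarrow> complex poly" where
  "word_act w n = foldr gen_act (letters w) n"

definition rep :: "generator free_algebra \<Rightarrow> (int \<Rightarrow> complex poly) \<Rightarrow> int \<Rightarrow> complex poly" where
  "rep a n j = (\<Sum>w\<in>Poly_Mapping.keys a. smult (Poly_Mapping.lookup a w) (word_act w n j))"

lemma gen_act_0: "gen_act x (\<lambda>_. 0) = (\<lambda>_. 0)"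
  by (cases x) auto

lemma gen_act_add: "gen_act x (\<lambda>j. n j + n' j) = (\<lambda>j. gen_act x n j + gen_act x n' j)"
  by (cases x) (auto simp: smult_add_right fun_eq_iff)

lemma gen_act_smult: "gen_act x (\<lambda>j. smult c (n j)) = (\<lambda>j. smult c (gen_act x n j))"
  by (cases x) (auto simp: smult_diff_right fun_eq_iff mult.commute mult.left_commute)

lemma rep_0 [simp]: "rep 0 n = (\<lambda>_. 0)"
  by (simp add: rep_def fun_eq_iff)

lemma rep_superset:
  assumes "finite S" "Poly_Mapping.keys a \<subseteq> S"
  shows "rep a n j = (\<Sum>w\<in>S. smult (Poly_Mapping.lookup a w) (word_act w n j))"
  unfolding rep_def using assms by (intro sum.mono_neutral_left) (auto simp: in_keys_iff)

lemma rep_add: "rep (a + b) n = (\<lambda>j. rep a n j + rep b n j)"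
proof
  fix j
  let ?S = "Poly_Mapping.keys a \<union> Poly_Mapping.keys b"
  have "rep c n j = (\<Sum>w\<in>?S. smult (Poly_Mapping.lookup c w) (word_act w n j))"
    if "c \<in> {a, b, a + b}" for c
    using that Poly_Mapping.keys_add[of a b] by (intro rep_superset) auto
  then show "rep (a + b) n j = rep a n j + rep b n j"
    by (simp add: lookup_add smult_add_left sum.distrib)
qed

lemma rep_single: "rep (Poly_Mapping.single w c) n = (\<lambda>j. smult c (word_act w n j))"
  by (cases "c = 0") (simp_all add: rep_def fun_eq_iff)

lemma rep_1 [simp]: "rep 1 n = n"
  using rep_single[of "Word []" 1 n] by (simp add: word_act_def single_Nil)

lemma rep_const_mult: "rep (const c * a) n = (\<lambda>j. smult c (rep a n j))"
  by (induction a rule: poly_mapping_additive_induct)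
     (auto simp: distrib_left rep_add smult_add_right const_def mult_single rep_single)

lemma rep_gen_mult: "rep (gen x * a) n = gen_act x (rep a n)"
proof (induction a rule: poly_mapping_additive_induct)
  case (single w c)
  then show ?case
    by (cases w) (simp add: gen_mult_single rep_single word_act_def gen_act_smult)
qed (auto simp: distrib_left rep_add gen_act_add gen_act_0)

lemma rep_const [simp]: "rep (const c) n = (\<lambda>j. smult c (n j))"
  using rep_const_mult[of c 1 n] by simp

lemma rep_gen [simp]: "rep (gen x) n = gen_act x n"
  using rep_gen_mult[of x 1 n] by simp

lemma rep_mult: "rep (a * b) n = rep a (rep b n)"
  by (induction a rule: free_algebra_induct)
     (auto simp: distrib_right rep_add mult.assoc rep_const_mult rep_gen_mult)

lemma rep_zero_vector: "rep a (\<lambda>_. 0) = (\<lambda>_. 0)"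
  by (induction a rule: free_algebra_induct)
     (auto simp: rep_add rep_const_mult rep_gen_mult gen_act_0)

lemma rep_uminus: "rep (- a) n = (\<lambda>j. - rep a n j)"
  using rep_const_mult[of "-1" a n] by (simp add: const_uminus)

lemma rep_diff: "rep (a - b) n = (\<lambda>j. rep a n j - rep b n j)"
  using rep_add[of a "- b" n] by (simp add: rep_uminus)

lemma rep_sum: "rep (sum f S) n = (\<lambda>j. \<Sum>i\<in>S. rep (f i) n j)"
  by (induction S rule: infinite_finite_induct) (auto simp: rep_add)

lemma rep_K_power: "rep (K ^ k) n = (\<lambda>j. n (j - int k))"
  by (induction k) (auto simp: rep_gen_mult fun_eq_iff algebra_simps)

lemma rep_Kinv_power: "rep (Kinv ^ k) n = (\<lambda>j. n (j + int k))"
  by (induction k) (auto simp: rep_gen_mult fun_eq_iff algebra_simps)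

lemma rep_Kpow: "rep (Kpow i) n = (\<lambda>j. n (j - i))"
  by (cases "i \<ge> 0") (auto simp: Kpow_def rep_K_power rep_Kinv_power)

lemma rep_F_E:
  "rep (F * E) n = (\<lambda>j. pCons 0 (n j) - smult cas_pos (n (j - int m)) - smult cas_neg (n (j + int m)))"
  using e_weight_nonzero by (simp add: rep_mult fun_eq_iff mult.assoc)

lemma rep_E_F:
  "rep (E * F) n = (\<lambda>j. pCons 0 (n j) - smult (cas_pos * inverse (q\<^sup>2) ^ m) (n (j - int m))
     - smult (cas_neg * (q\<^sup>2) ^ m) (n (j + int m)))"
proof -
  have coeff: "e_weight j * (c * inverse (e_weight (j - int m))) = c * inverse (q\<^sup>2) ^ m"
    "e_weight j * (c * inverse (e_weight (j + int m))) = c * (q\<^sup>2) ^ m" for c j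
    using e_weight_nonzero[of j] q_nonzero by (simp_all add: e_weight_shift power_inverse)
  show ?thesis
    using e_weight_nonzero by (simp add: rep_mult fun_eq_iff smult_diff_right coeff)
qed

lemma rep_relator: "a \<in> U_relators q m \<Longrightarrow> rep a n = (\<lambda>_. 0)"
proof -
  have 1: "rep (K * E - const (q\<^sup>2) * E * K) n = (\<lambda>_. 0)"
    using e_weight_shift(1)[of _ 1]
    by (simp add: rep_diff rep_mult fun_eq_iff)
  have 2: "rep (K * F - const (inverse (q\<^sup>2)) * F * K) n = (\<lambda>_. 0)"
  proof -
    have *: "inverse (e_weight (i - 1)) = inverse (q\<^sup>2) * inverse (e_weight i)" for i
      using e_weight_shift(1)[of i 1] by simp
    have "e_weight (j - 1 - int m) = e_weight (j - int m - 1)"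
      "e_weight (j - 1 + int m) = e_weight (j + int m - 1)" for j
      by (simp_all add: algebra_simps)
    moreover have "n (j - 1 - int m) = n (j - int m - 1)" "n (j - 1 + int m) = n (j + int m - 1)" for j
      by (simp_all add: algebra_simps)
    ultimately show ?thesis
      by (simp add: rep_diff rep_mult fun_eq_iff * smult_diff_right mult.left_commute)
  qed
  have 3: "rep (K * Kinv - 1) n = (\<lambda>_. 0)" "rep (Kinv * K - 1) n = (\<lambda>_. 0)"
    by (simp_all add: rep_diff rep_mult fun_eq_iff)
  have 4: "rep (E * F - F * E - const (inverse (q - inverse q)) * (K ^ m - Kinv ^ m)) n = (\<lambda>_. 0)"
  proof (cases "m = 0")
    case True
    show ?thesis
      unfolding rep_diff rep_E_F rep_F_E rep_const_mult rep_K_power rep_Kinv_power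
      by (simp add: True)
  next
    case False
    have "smult cas_pos = smult (cas_pos * inverse (q\<^sup>2) ^ m + inverse (q - inverse q))"
      "smult cas_neg = smult (cas_neg * (q\<^sup>2) ^ m - inverse (q - inverse q))"
      using cas_coefficients[OF False] by simp_all
    then show ?thesis
      unfolding rep_diff rep_E_F rep_F_E rep_const_mult rep_K_power rep_Kinv_power
      by (simp add: fun_eq_iff smult_add_left smult_diff_left smult_diff_right)
  qed
  show "rep a n = (\<lambda>_. 0)" if "a \<in> U_relators q m"
    using that 1 2 3 4 unfolding U_relators_def by auto
qed

lemma rep_ideal:
  assumes "a \<in> U_ideal q m"
  shows "rep a n = (\<lambda>_. 0)"
proof -
  interpret A: ring "ring_of_type_algebra :: generator free_algebra ring"
    by (rule ring_ring_of_type_algebra)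
  define Ker where "Ker = {a. \<forall>n. rep a n = (\<lambda>_. 0)}"
  have "ideal Ker ring_of_type_algebra"
  proof (rule idealI[OF A.ring_axioms])
    show "subgroup Ker (add_monoid ring_of_type_algebra)"
    proof (rule A.add.subgroupI)
      show "Ker \<subseteq> carrier ring_of_type_algebra" "Ker \<noteq> {}"
        by (auto simp: Ker_def ring_of_type_algebra_def intro: exI[of _ 0])
      show "\<ominus>\<^bsub>ring_of_type_algebra\<^esub> a \<in> Ker" if "a \<in> Ker" for a
        using that by (simp add: Ker_def additive_inverse_type_algebra rep_uminus)
      show "a \<oplus>\<^bsub>ring_of_type_algebra\<^esub> b \<in> Ker" if "a \<in> Ker" "b \<in> Ker" for a b
        using that by (simp add: Ker_def ring_of_type_algebra_def rep_add)
    qed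
    show "x \<otimes>\<^bsub>ring_of_type_algebra\<^esub> a \<in> Ker" "a \<otimes>\<^bsub>ring_of_type_algebra\<^esub> x \<in> Ker"
      if "a \<in> Ker" for a x
      using that by (simp_all add: Ker_def ring_of_type_algebra_def rep_mult rep_zero_vector)
  qed
  moreover have "U_relators q m \<subseteq> Ker"
    using rep_relator by (auto simp: Ker_def)
  ultimately have "U_ideal q m \<subseteq> Ker"
    unfolding U_ideal_def by (rule A.genideal_minimal)
  then show ?thesis using assms by (auto simp: Ker_def)
qed

lemma rep_cong: "a \<doteq> b \<Longrightarrow> rep a n = rep b n"
  using rep_ideal[of "a - b" n] by (simp add: cong_def rep_diff fun_eq_iff)

lemma rep_Casimir: "rep Casimir n = (\<lambda>j. pCons 0 (n j))"
  unfolding Casimir_def cas_K_def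
  by (simp only: rep_add rep_F_E rep_const_mult rep_K_power rep_Kinv_power) simp

lemma rep_cas_poly: "rep (cas_poly p) n = (\<lambda>j. p * n j)"
  by (induction p) (auto simp: rep_add rep_mult rep_Casimir)

definition cyclic_vector :: "int \<Rightarrow> complex poly" where
  "cyclic_vector j = (if j = 0 then 1 else 0)"

lemma rep_laurent:
  assumes "finite S"
  shows "rep (laurent S p) cyclic_vector j = (if j \<in> S then p j else 0)"
proof -
  have "rep (laurent S p) cyclic_vector j = (\<Sum>i\<in>S. if i = j then p i else 0)"
    unfolding laurent_def rep_sum
    by (rule sum.cong) (auto simp: rep_mult rep_cas_poly rep_Kpow cyclic_vector_def)
  then show ?thesis using assms by simp
qed

text \<open>
  By \<open>rep_laurent\<close>, the coefficient of \<open>K\<^sup>j\<close> in \<open>z\<close> is the coefficient of \<open>t\<^sup>j\<close> in \<open>z 1\<close>.  This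
  vector is an eigenvector of \<open>E\<close> with eigenvalue \<open>e\<close>, as \<open>1\<close> is, so it has no term with \<open>j \<noteq> 0\<close>.
\<close>
lemma central_imp_cas_poly:
  assumes central: "\<And>a. z * a \<doteq> a * z"
  shows "\<exists>p. z \<doteq> cas_poly p"
proof -
  have "z \<in> weight0"
    by (rule commutes_with_K_imp_weight0) (rule cong_sym[OF central])
  then obtain S p where S: "finite S" and z: "z \<doteq> laurent S p"
    using weight0_laurent by blast
  have rep_z: "rep z cyclic_vector j = (if j \<in> S then p j else 0)" for j
    using rep_cong[OF z] S by (simp add: rep_laurent)
  have E_cyclic_vector: "rep E cyclic_vector = rep (const e) cyclic_vector"
    by (auto simp: cyclic_vector_def e_weight_def fun_eq_iff)
  have "smult e (rep z cyclic_vector j) = smult (e_weight j) (rep z cyclic_vector j)" for j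
  proof -
    have "rep (E * z) cyclic_vector j = rep (z * const e) cyclic_vector j"
      using fun_cong[OF rep_cong[OF central[of E]], of cyclic_vector j] by (simp only: rep_mult E_cyclic_vector)
    then show ?thesis
      by (simp add: rep_gen_mult rep_const_mult flip: const_commute)
  qed
  then have p_0: "p j = 0" if "j \<in> S" "j \<noteq> 0" for j
    using that rep_z[of j] e_weight_inj[of 0 j] smult_eq_iff
    by (metis (no_types, opaque_lifting) diff_eq_eq e_weight_def eq_iff_diff_eq_0 minus_zero
        mult.right_neutral power_int_0_right smult_diff_left smult_eq_0_iff)
  have "laurent S p = laurent (S \<inter> {0}) p"
    unfolding laurent_def using S p_0 by (intro sum.mono_neutral_right) auto
  also have "\<dots> = cas_poly (if 0 \<in> S then p 0 else 0)"
    by (cases "0 \<in> S") (auto simp: laurent_def)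
  finally show ?thesis using z by metis
qed


section \<open>Left ideals annihilating a cyclic Whittaker vector\<close>

text \<open>
  The preimages in the free algebra of the left ideals of \<open>U\<close> that contain \<open>E - e\<close>, that is, of the
  annihilators of vectors \<open>v\<close> with \<open>E v = e v\<close>.
\<close>
definition whittaker_left_ideal :: "generator free_algebra set \<Rightarrow> bool" where
  "whittaker_left_ideal L \<longleftrightarrow> U_ideal q m \<subseteq> L \<and> E - const e \<in> L \<and>
     (\<forall>a\<in>L. \<forall>b\<in>L. a + b \<in> L) \<and> (\<forall>x. \<forall>a\<in>L. x * a \<in> L)"

context
  fixes L
  assumes L: "whittaker_left_ideal L"
begin

lemma left_ideal_U_ideal: "a \<in> U_ideal q m \<Longrightarrow> a \<in> L"
  and left_ideal_E: "E - const e \<in> L"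
  and left_ideal_add: "a \<in> L \<Longrightarrow> b \<in> L \<Longrightarrow> a + b \<in> L"
  and left_ideal_mult: "a \<in> L \<Longrightarrow> x * a \<in> L"
  using L by (auto simp: whittaker_left_ideal_def)

lemma left_ideal_diff: "a \<in> L \<Longrightarrow> b \<in> L \<Longrightarrow> a - b \<in> L"
  using left_ideal_add[of a "(- 1) * b"] left_ideal_mult[of b "- 1"] by simp

lemma left_ideal_mem_iff: "a - b \<in> L \<Longrightarrow> a \<in> L \<longleftrightarrow> b \<in> L"
  using left_ideal_add[of "a - b" b] left_ideal_diff[of a "a - b"] by auto

lemma left_ideal_diff_trans: "a - b \<in> L \<Longrightarrow> b - c \<in> L \<Longrightarrow> a - c \<in> L"
  using left_ideal_add[of "a - b" "b - c"] by simp

lemma left_ideal_cong: "a \<doteq> b \<Longrightarrow> a - b \<in> L"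
  by (auto simp: cong_def intro: left_ideal_U_ideal)

lemma left_ideal_sum: "(\<And>i. i \<in> S \<Longrightarrow> f i \<in> L) \<Longrightarrow> sum f S \<in> L"
  by (induction S rule: infinite_finite_induct) (auto intro: left_ideal_add left_ideal_U_ideal U_ideal_0)

text \<open>
  Here \<open>e \<noteq> 0\<close> is essential: it allows \<open>F\<close> to be replaced by \<open>e\<^sup>-\<^sup>1FE = e\<^sup>-\<^sup>1(\<Omega> - c(K))\<close>.
\<close>
lemma reduce_to_weight0: "\<exists>r\<in>weight0. a - r \<in> L"
proof (induction a rule: free_algebra_induct)
  case one
  show ?case using left_ideal_U_ideal[OF U_ideal_0] by (intro bexI[of _ 1]) (auto intro: weight0_one)
next
  case (add a b)
  then obtain r s where "r \<in> weight0" "s \<in> weight0" "a - r \<in> L" "b - s \<in> L" by blast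
  then show ?case
    using left_ideal_add[of "a - r" "b - s"]
    by (intro bexI[of _ "r + s"]) (auto simp: algebra_simps intro: weight0_add)
next
  case (const_mult c a)
  then obtain r where "r \<in> weight0" "a - r \<in> L" by blast
  then show ?case
    using left_ideal_mult[of "a - r" "const c"]
    by (intro bexI[of _ "const c * r"]) (auto simp: algebra_simps intro: weight0_const)
next
  case (gen_mult x a)
  then obtain r where r: "r \<in> weight0" "a - r \<in> L" by blast
  have "\<exists>s\<in>weight0. gen x * r - s \<in> L"
  proof (cases x)
    case GE
    obtain b where b: "b \<in> weight0" "E * r \<doteq> b * E" using E_weight0[OF r(1)] by blast
    have "b * E - const e * b \<in> L"
      using left_ideal_mult[OF left_ideal_E, of b] by (simp add: right_diff_distrib const_commute)
    then have "E * r - const e * b \<in> L"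
      using left_ideal_diff_trans left_ideal_cong[OF b(2)] by blast
    then show ?thesis using GE b(1) by (blast intro: weight0_const)
  next
    case GF
    obtain b where b: "b \<in> weight0" "F * r \<doteq> b * F" using F_weight0[OF r(1)] by blast
    let ?s = "const (inverse e) * (b * (Casimir - cas_K))"
    have "const (inverse e) * (b * F) * (E - const e) \<in> L"
      by (rule left_ideal_mult[OF left_ideal_E])
    also have "const (inverse e) * (b * F) * (E - const e) = ?s - b * F"
      using e_nonzero
      by (simp add: right_diff_distrib mult.assoc flip: F_mult_E const_commute)
         (simp add: const_const_mult const_left_commute[of b] const_left_commute[of F])
    finally have "b * F - ?s \<in> L"
      using left_ideal_mult[of "?s - b * F" "- 1"] by simp
    then have "F * r - ?s \<in> L"
      using left_ideal_diff_trans left_ideal_cong[OF b(2)] by blast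
    moreover have "?s \<in> weight0"
      by (intro weight0_const weight0_mult b(1) weight0_diff weight0_gens cas_K_in_weight0)
    ultimately show ?thesis using GF by blast
  next
    case GK
    then show ?thesis using weight0_K[OF r(1)] left_ideal_U_ideal[OF U_ideal_0] by (metis diff_self)
  next
    case GKinv
    then show ?thesis using weight0_Kinv[OF r(1)] left_ideal_U_ideal[OF U_ideal_0] by (metis diff_self)
  qed
  moreover have "gen x * a - gen x * r \<in> L"
    using left_ideal_mult[OF r(2), of "gen x"] by (simp add: right_diff_distrib)
  ultimately show ?case using left_ideal_diff_trans by blast
qed

text \<open>
  The terms \<open>K\<^sup>j p\<^sub>j(\<Omega>)\<close> are eigenvectors of \<open>E\<close> modulo \<open>L\<close> with distinct eigenvalues, and the powers of
  \<open>K\<close> are units.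
\<close>
lemma laurent_coefficient_mem:
  assumes "finite S" "laurent S p \<in> L" "j \<in> S"
  shows "cas_poly (p j) \<in> L"
proof -
  have "Kpow j * cas_poly (p j) \<in> L"
  proof (rule eigenvectors_independent[where S = S and i = j and T = "\<lambda>a. E * a" and \<mu> = e_weight
        and f = "\<lambda>j. Kpow j * cas_poly (p j)"])
    show "inj_on e_weight S"
      by (auto intro: inj_onI e_weight_inj)
    show "(\<Sum>j\<in>S. Kpow j * cas_poly (p j)) \<in> L"
      using assms(2) by (simp add: laurent_def)
    show "E * (Kpow i * cas_poly (p i)) - const (e_weight i) * (Kpow i * cas_poly (p i)) \<in> L" for i
    proof -
      let ?c = "const ((q\<^sup>2) powi (- i))"
      have "E * (Kpow i * cas_poly (p i)) = (E * Kpow i) * cas_poly (p i)"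
        by (simp add: mult.assoc)
      also have "\<dots> \<doteq> ?c * (Kpow i * E) * cas_poly (p i)"
        by (intro cong_mult_right E_Kpow)
      also have "\<dots> = ?c * Kpow i * (E * cas_poly (p i))"
        by (simp add: mult.assoc)
      also have "\<dots> \<doteq> ?c * Kpow i * (cas_poly (p i) * E)"
        by (intro cong_mult_left cas_poly_central)
      finally have "E * (Kpow i * cas_poly (p i)) - ?c * Kpow i * (cas_poly (p i) * E) \<in> L"
        by (rule left_ideal_cong)
      moreover have "?c * Kpow i * cas_poly (p i) * (E - const e) \<in> L"
        by (rule left_ideal_mult[OF left_ideal_E])
      then have "?c * Kpow i * (cas_poly (p i) * E) - const (e_weight i) * (Kpow i * cas_poly (p i)) \<in> L"
        by (simp add: right_diff_distrib mult.assoc e_weight_def const_mult flip: const_commute[of e])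
      ultimately show ?thesis by (rule left_ideal_diff_trans)
    qed
  qed (use assms in \<open>auto intro: left_ideal_add left_ideal_mult simp: distrib_left const_left_commute[of E]\<close>)
  then have "Kpow (- j) * (Kpow j * cas_poly (p j)) \<in> L"
    by (rule left_ideal_mult)
  moreover have "Kpow (- j) * (Kpow j * cas_poly (p j)) \<doteq> cas_poly (p j)"
    using cong_mult_right[OF Kpow_inverse, of j "cas_poly (p j)"] by (simp add: mult.assoc)
  ultimately show ?thesis
    using left_ideal_mem_iff left_ideal_cong by blast
qed

end

text \<open>
  An element is congruent to some \<open>\<Sum>\<^sub>j K\<^sup>j p\<^sub>j(\<Omega>)\<close>, and it lies in \<open>L\<close> exactly when all \<open>p\<^sub>j(\<Omega>)\<close> do.
\<close>
lemma whittaker_left_ideal_subset: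
  assumes L: "whittaker_left_ideal L" and M: "whittaker_left_ideal M"
    and subset: "\<And>p. cas_poly p \<in> L \<Longrightarrow> cas_poly p \<in> M"
  shows "L \<subseteq> M"
proof
  fix a assume a: "a \<in> L"
  \<comment> \<open>Working modulo the intersection gives one reduction of \<open>a\<close> that is valid for both ideals.\<close>
  have "whittaker_left_ideal (L \<inter> M)"
    using L M by (auto simp: whittaker_left_ideal_def)
  then obtain r where r: "r \<in> weight0" "a - r \<in> L" "a - r \<in> M"
    using reduce_to_weight0[of "L \<inter> M" a] by blast
  obtain S p where S: "finite S" "r \<doteq> laurent S p"
    using weight0_laurent[OF r(1)] by blast
  have "laurent S p \<in> L"
    using a left_ideal_mem_iff[OF L r(2)] left_ideal_mem_iff[OF L left_ideal_cong[OF L S(2)]] by blast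
  then have "cas_poly (p j) \<in> M" if "j \<in> S" for j
    using laurent_coefficient_mem[OF L S(1)] subset that by blast
  then have "laurent S p \<in> M"
    unfolding laurent_def by (intro left_ideal_sum[OF M] left_ideal_mult[OF M])
  then show "a \<in> M"
    using left_ideal_mem_iff[OF M r(3)] left_ideal_mem_iff[OF M left_ideal_cong[OF M S(2)]] by blast
qed

text \<open>The annihilator of the vector \<open>1\<close> in the quotient \<open>(\<complex>[x]/J)[t\<^sup>\<plusminus>\<^sup>1]\<close> of the universal module.\<close>
definition left_ideal_of :: "complex poly set \<Rightarrow> generator free_algebra set" where
  "left_ideal_of J = {a. \<forall>j. rep a cyclic_vector j \<in> J}"

lemma whittaker_left_ideal_of:
  assumes add: "\<And>p r. p \<in> J \<Longrightarrow> r \<in> J \<Longrightarrow> p + r \<in> J"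
    and mult: "\<And>p r. r \<in> J \<Longrightarrow> p * r \<in> J" and zero: "0 \<in> J"
  shows "whittaker_left_ideal (left_ideal_of J)"
proof -
  have smult: "smult c r \<in> J" if "r \<in> J" for c r
    using mult[OF that, of "[:c:]"] by simp
  have pCons: "pCons 0 r \<in> J" if "r \<in> J" for r
    using mult[OF that, of "[:0, 1:]"] by simp
  have diff: "p - r \<in> J" if "p \<in> J" "r \<in> J" for p r
    using add[OF that(1) smult[OF that(2), of "-1"]] by simp
  have gen: "gen_act x n j \<in> J" if "\<And>j. n j \<in> J" for x n j
    using that by (cases x) (auto intro!: diff smult pCons)
  have "rep x n j \<in> J" if "\<And>j. n j \<in> J" for x n j
    using that
    by (induction x arbitrary: j rule: free_algebra_induct)
       (auto simp: rep_add rep_const_mult rep_gen_mult intro: add smult gen)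
  then show ?thesis
    using add zero
    by (auto simp: whittaker_left_ideal_def left_ideal_of_def rep_ideal rep_add rep_mult rep_diff
        cyclic_vector_def e_weight_def)
qed


section \<open>The center and the annihilators of Whittaker vectors\<close>

lemma class_in_center_iff: "U_class q m z \<in> ring_center (Uq q m) \<longleftrightarrow> (\<forall>a. z * a \<doteq> a * z)"
proof
  assume "U_class q m z \<in> ring_center (Uq q m)"
  then show "\<forall>a. z * a \<doteq> a * z"
    by (simp add: ring_center_def cong_iff_class U_class_mult)
next
  assume commute: "\<forall>a. z * a \<doteq> a * z"
  have "U_class q m z \<otimes>\<^bsub>Uq q m\<^esub> u = u \<otimes>\<^bsub>Uq q m\<^esub> U_class q m z"
    if "u \<in> carrier (Uq q m)" for u
  proof -
    obtain a where "u = U_class q m a"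
      using carrier_UqE[OF \<open>u \<in> carrier (Uq q m)\<close>] .
    then show ?thesis
      using commute by (simp add: cong_iff_class flip: U_class_mult)
  qed
  then show "U_class q m z \<in> ring_center (Uq q m)"
    by (simp add: ring_center_def)
qed

lemma class_cas_poly_in_center: "U_class q m (cas_poly p) \<in> ring_center (Uq q m)"
  unfolding class_in_center_iff by (blast intro: cong_sym cas_poly_central)

text \<open>
  The identification of the center rests on the explicit module through \<open>central_imp_cas_poly\<close>.
\<close>
lemma center_eq_cas_poly: "ring_center (Uq q m) = range (\<lambda>p. U_class q m (cas_poly p))"
proof
  show "ring_center (Uq q m) \<subseteq> range (\<lambda>p. U_class q m (cas_poly p))"
  proof
    fix u assume u: "u \<in> ring_center (Uq q m)"
    then obtain z where z: "u = U_class q m z"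
      by (auto simp: ring_center_def elim: carrier_UqE)
    then obtain p where "z \<doteq> cas_poly p"
      using u central_imp_cas_poly[of z] by (auto simp: class_in_center_iff)
    then show "u \<in> range (\<lambda>p. U_class q m (cas_poly p))"
      by (auto simp: z cong_iff_class)
  qed
qed (use class_cas_poly_in_center in auto)

definition vector_ideal :: "(U_elem, 'v) module \<Rightarrow> 'v \<Rightarrow> generator free_algebra set" where
  "vector_ideal V v = {a. U_class q m a \<odot>\<^bsub>V\<^esub> v = \<zero>\<^bsub>V\<^esub>}"

lemma whittaker_vector_ideal:
  assumes "left_module (Uq q m) V" and "v \<in> carrier V"
    and Ev: "U_E q m \<odot>\<^bsub>V\<^esub> v = U_scalar q m e \<odot>\<^bsub>V\<^esub> v"
  shows "whittaker_left_ideal (vector_ideal V v)"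
proof -
  interpret V: left_module "Uq q m" V by fact
  have zero: "U_class q m a \<odot>\<^bsub>V\<^esub> v = \<zero>\<^bsub>V\<^esub>" if "a \<in> U_ideal q m" for a
  proof -
    have "U_class q m a = \<zero>\<^bsub>Uq q m\<^esub>"
      using that by (simp add: U_class_eq_iff flip: U_class_0)
    then show ?thesis using assms(2) by (simp add: V.smult_zero_left)
  qed
  have "U_class q m (E - const e) \<odot>\<^bsub>V\<^esub> v \<oplus>\<^bsub>V\<^esub> U_class q m (const e) \<odot>\<^bsub>V\<^esub> v = U_class q m E \<odot>\<^bsub>V\<^esub> v"
    using assms(2) by (simp flip: V.smult_l_distr U_class_add)
  then have "U_class q m (E - const e) \<odot>\<^bsub>V\<^esub> v = \<zero>\<^bsub>V\<^esub>"
    using Ev assms(2) V.M.add.r_cancel_one' by (simp add: U_E_def U_scalar_def)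
  then show ?thesis
    using zero assms(2)
    by (auto simp: whittaker_left_ideal_def vector_ideal_def U_class_add U_class_mult
        V.smult_l_distr V.smult_assoc V.smult_zero_right)
qed

text \<open>A central element that kills the generator kills the whole module.\<close>
lemma central_annihilator_cyclic:
  assumes "left_module (Uq q m) V" and "v \<in> carrier V"
    and V: "carrier V = {u \<odot>\<^bsub>V\<^esub> v | u. u \<in> carrier (Uq q m)}"
  shows "U_class q m (cas_poly p) \<in> central_annihilator q m V \<longleftrightarrow> cas_poly p \<in> vector_ideal V v"
proof
  interpret V: left_module "Uq q m" V by fact
  show "cas_poly p \<in> vector_ideal V v" if "U_class q m (cas_poly p) \<in> central_annihilator q m V"
    using that assms(2) by (auto simp: central_annihilator_def annihilator_def vector_ideal_def)
  assume 0: "cas_poly p \<in> vector_ideal V v"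
  let ?z = "U_class q m (cas_poly p)"
  have "?z \<odot>\<^bsub>V\<^esub> (u \<odot>\<^bsub>V\<^esub> v) = \<zero>\<^bsub>V\<^esub>" if "u \<in> carrier (Uq q m)" for u
  proof -
    have "?z \<odot>\<^bsub>V\<^esub> (u \<odot>\<^bsub>V\<^esub> v) = (?z \<otimes>\<^bsub>Uq q m\<^esub> u) \<odot>\<^bsub>V\<^esub> v"
      using that assms(2) by (simp add: V.smult_assoc)
    also have "?z \<otimes>\<^bsub>Uq q m\<^esub> u = u \<otimes>\<^bsub>Uq q m\<^esub> ?z"
      using class_cas_poly_in_center that by (simp add: ring_center_def)
    also have "(u \<otimes>\<^bsub>Uq q m\<^esub> ?z) \<odot>\<^bsub>V\<^esub> v = \<zero>\<^bsub>V\<^esub>"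
      using that assms(2) 0 by (simp add: V.smult_assoc vector_ideal_def V.smult_zero_right)
    finally show ?thesis .
  qed
  then show "?z \<in> central_annihilator q m V"
    using class_cas_poly_in_center
    by (auto simp: central_annihilator_def annihilator_def V)
qed

lemma module_of_whittaker_left_ideal:
  assumes L: "whittaker_left_ideal L" and "1 \<notin> L"
    and small: "carrier (Uq q m) \<lesssim> (UNIV :: 'v set)"
  shows "\<exists>(V :: (U_elem, 'v) module) v. left_module (Uq q m) V \<and> v \<in> carrier V \<and> v \<noteq> \<zero>\<^bsub>V\<^esub> \<and>
    U_E q m \<odot>\<^bsub>V\<^esub> v = U_scalar q m e \<odot>\<^bsub>V\<^esub> v \<and>
    carrier V = {u \<odot>\<^bsub>V\<^esub> v | u. u \<in> carrier (Uq q m)} \<and> vector_ideal V v = L"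
proof -
  interpret U: ring "Uq q m" by (rule ring_Uq)
  have mem: "U_class q m a \<in> U_class q m ` L \<longleftrightarrow> a \<in> L" for a
    using left_ideal_mem_iff[OF L left_ideal_U_ideal[OF L]] by (auto simp: U_class_eq_iff)
  have minus: "\<ominus>\<^bsub>Uq q m\<^esub> U_class q m a = U_class q m (- a)" for a
    by (rule U.minus_equality) (simp_all add: U_class_0 flip: U_class_add)
  have subgroup: "additive_subgroup (U_class q m ` L) (Uq q m)"
  proof (intro additive_subgroup.intro U.add.subgroupI)
    show "U_class q m ` L \<noteq> {}"
      using left_ideal_E[OF L] by blast
    show "\<ominus>\<^bsub>Uq q m\<^esub> u \<in> U_class q m ` L" if "u \<in> U_class q m ` L" for u
      using that left_ideal_mult[OF L, of _ "- 1"] by (auto simp: minus)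
    show "u \<oplus>\<^bsub>Uq q m\<^esub> u' \<in> U_class q m ` L"
      if "u \<in> U_class q m ` L" "u' \<in> U_class q m ` L" for u u'
      using that left_ideal_add[OF L] by (auto simp flip: U_class_add)
  qed auto
  have left_mult: "\<forall>x\<in>carrier (Uq q m). \<forall>u\<in>U_class q m ` L. x \<otimes>\<^bsub>Uq q m\<^esub> u \<in> U_class q m ` L"
    using left_ideal_mult[OF L] by (auto elim!: carrier_UqE simp flip: U_class_mult)
  from cyclic_module_of_left_ideal[OF ring_Uq subgroup left_mult small]
  obtain V :: "(U_elem, 'v) module" and v where V: "left_module (Uq q m) V"
    and v: "v \<in> carrier V" "carrier V = {u \<odot>\<^bsub>V\<^esub> v | u. u \<in> carrier (Uq q m)}"
    and ann: "\<forall>u\<in>carrier (Uq q m). u \<odot>\<^bsub>V\<^esub> v = \<zero>\<^bsub>V\<^esub> \<longleftrightarrow> u \<in> U_class q m ` L"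
    by (elim exE conjE) (rule that)
  interpret V: left_module "Uq q m" V by (rule V)
  have ideal: "vector_ideal V v = L"
    using ann mem by (auto simp: vector_ideal_def)
  have "v \<noteq> \<zero>\<^bsub>V\<^esub>"
    using bspec[OF ann, of "U_class q m 1"] mem[of 1] v(1) \<open>1 \<notin> L\<close> by (simp add: U_class_1)
  moreover have "U_class q m (E - const e) \<odot>\<^bsub>V\<^esub> v = \<zero>\<^bsub>V\<^esub>"
    using ann mem left_ideal_E[OF L] by simp
  then have "U_class q m (E - const e) \<odot>\<^bsub>V\<^esub> v \<oplus>\<^bsub>V\<^esub> U_class q m (const e) \<odot>\<^bsub>V\<^esub> v
      = U_class q m (const e) \<odot>\<^bsub>V\<^esub> v"
    using v(1) by simp
  then have "U_E q m \<odot>\<^bsub>V\<^esub> v = U_scalar q m e \<odot>\<^bsub>V\<^esub> v"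
    using v(1) by (simp add: U_E_def U_scalar_def flip: V.smult_l_distr U_class_add)
  ultimately show ?thesis using V v ideal by blast
qed

section \<open>Ideals of the center and Whittaker modules\<close>

context
  fixes \<eta>
  assumes \<eta>_E: "\<eta> (U_E q m) = e"
begin

lemma whittaker_modulesE:
  assumes "V \<in> whittaker_modules q m \<eta>"
  obtains v where "left_module (Uq q m) V" "v \<in> carrier V" "v \<noteq> \<zero>\<^bsub>V\<^esub>"
    "U_E q m \<odot>\<^bsub>V\<^esub> v = U_scalar q m e \<odot>\<^bsub>V\<^esub> v"
    "carrier V = {u \<odot>\<^bsub>V\<^esub> v | u. u \<in> carrier (Uq q m)}"
  using assms unfolding whittaker_modules_def whittaker_vector_def \<eta>_E by blast

lemma central_annihilator_ideal:
  assumes "V \<in> whittaker_modules q m \<eta>"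
  shows "ideal (central_annihilator q m V) (center_ring (Uq q m))"
    and "central_annihilator q m V \<noteq> ring_center (Uq q m)"
proof -
  obtain v where V: "left_module (Uq q m) V" "v \<in> carrier V" "v \<noteq> \<zero>\<^bsub>V\<^esub>"
    using whittaker_modulesE[OF assms] by blast
  interpret V: left_module "Uq q m" V by (rule V)
  show "ideal (central_annihilator q m V) (center_ring (Uq q m))"
    unfolding central_annihilator_def by (rule ideal_central_annihilator[OF V(1)])
  have "\<one>\<^bsub>Uq q m\<^esub> \<in> ring_center (Uq q m)"
    by (simp add: ring_center_def)
  moreover have "\<one>\<^bsub>Uq q m\<^esub> \<notin> central_annihilator q m V"
    using V by (auto simp: central_annihilator_def annihilator_def)
  ultimately show "central_annihilator q m V \<noteq> ring_center (Uq q m)" by blast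
qed

text \<open>
  The central annihilator fixes which \<open>p(\<Omega>)\<close> kill the generators \<open>v\<close> and \<open>w\<close>, hence their full
  annihilators.
\<close>
lemma central_annihilator_determines_module:
  assumes "V \<in> whittaker_modules q m \<eta>" "W \<in> whittaker_modules q m \<eta>"
    and eq: "central_annihilator q m V = central_annihilator q m W"
  shows "(V, W) \<in> whittaker_equiv q m \<eta>"
proof -
  obtain v where v: "left_module (Uq q m) V" "v \<in> carrier V"
    "U_E q m \<odot>\<^bsub>V\<^esub> v = U_scalar q m e \<odot>\<^bsub>V\<^esub> v"
    "carrier V = {u \<odot>\<^bsub>V\<^esub> v | u. u \<in> carrier (Uq q m)}"
    using whittaker_modulesE[OF assms(1)] by blast
  obtain w where w: "left_module (Uq q m) W" "w \<in> carrier W"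
    "U_E q m \<odot>\<^bsub>W\<^esub> w = U_scalar q m e \<odot>\<^bsub>W\<^esub> w"
    "carrier W = {u \<odot>\<^bsub>W\<^esub> w | u. u \<in> carrier (Uq q m)}"
    using whittaker_modulesE[OF assms(2)] by blast
  have "cas_poly p \<in> vector_ideal V v \<longleftrightarrow> cas_poly p \<in> vector_ideal W w" for p
    using central_annihilator_cyclic[OF v(1,2,4)] central_annihilator_cyclic[OF w(1,2,4)] eq by simp
  then have "vector_ideal V v = vector_ideal W w"
    using whittaker_left_ideal_subset whittaker_vector_ideal[OF v(1,2,3)]
      whittaker_vector_ideal[OF w(1,2,3)] by (metis subset_antisym)
  then have "u \<odot>\<^bsub>V\<^esub> v = \<zero>\<^bsub>V\<^esub> \<longleftrightarrow> u \<odot>\<^bsub>W\<^esub> w = \<zero>\<^bsub>W\<^esub>" if "u \<in> carrier (Uq q m)" for u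
    using that by (elim carrier_UqE) (auto simp: vector_ideal_def)
  then have "left_module_iso (Uq q m) V W \<noteq> {}"
    by (rule cyclic_modules_isomorphic[OF v(1) w(1) v(2) w(2) v(4) w(4)])
  then show ?thesis using assms by (simp add: whittaker_equiv_def)
qed

text \<open>
  The module is \<open>U\<close> modulo the annihilator of \<open>1\<close> in \<open>(\<complex>[x]/J)[t\<^sup>\<plusminus>\<^sup>1]\<close>, where \<open>J\<close> corresponds to \<open>I\<close>
  under \<open>p \<mapsto> p(\<Omega>)\<close>.  As \<open>p(\<Omega>)\<close> sends \<open>1\<close> to \<open>p\<close>, it lies in this annihilator exactly when \<open>p \<in> J\<close>.
\<close>
lemma central_ideal_realized:
  assumes I: "ideal I (center_ring (Uq q m))" "I \<noteq> ring_center (Uq q m)"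
    and small: "carrier (Uq q m) \<lesssim> (UNIV :: 'v set)"
  shows "\<exists>V :: (U_elem, 'v) module. V \<in> whittaker_modules q m \<eta> \<and> central_annihilator q m V = I"
proof -
  interpret I: ideal I "center_ring (Uq q m)" by (rule I)
  define J where "J = {p. U_class q m (cas_poly p) \<in> I}"
  have Z: "carrier (center_ring (Uq q m)) = ring_center (Uq q m)"
    "(\<oplus>\<^bsub>center_ring (Uq q m)\<^esub>) = (\<oplus>\<^bsub>Uq q m\<^esub>)" "(\<otimes>\<^bsub>center_ring (Uq q m)\<^esub>) = (\<otimes>\<^bsub>Uq q m\<^esub>)"
    "\<zero>\<^bsub>center_ring (Uq q m)\<^esub> = \<zero>\<^bsub>Uq q m\<^esub>" "\<one>\<^bsub>center_ring (Uq q m)\<^esub> = \<one>\<^bsub>Uq q m\<^esub>"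
    by (auto simp: center_ring_def)
  have zero: "0 \<in> J"
    using additive_subgroup.zero_closed[OF I.is_additive_subgroup] by (simp add: J_def Z U_class_0)
  have add: "p + r \<in> J" if "p \<in> J" "r \<in> J" for p r
    using that additive_subgroup.a_closed[OF I.is_additive_subgroup]
    by (simp add: J_def Z U_class_add cas_poly_add)
  have mult: "p * r \<in> J" if "r \<in> J" for p r
  proof (induction p)
    case (pCons c p)
    have times: "U_class q m (cas_poly s * cas_poly t) \<in> I" if "t \<in> J" for s t
      using that I.I_l_closed[of "U_class q m (cas_poly t)" "U_class q m (cas_poly s)"]
        class_cas_poly_in_center by (simp add: J_def Z U_class_mult)
    have "smult c r \<in> J"
      using times[OF \<open>r \<in> J\<close>, of "[:c:]"] by (simp add: J_def cas_poly_smult)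
    moreover have "pCons 0 (p * r) \<in> J"
      using times[OF pCons.IH, of "[:0, 1:]"] by (simp add: J_def)
    ultimately show ?case using add by (simp add: add.commute)
  qed (simp add: zero)
  have L: "whittaker_left_ideal (left_ideal_of J)"
    by (rule whittaker_left_ideal_of) (use add mult zero in auto)
  have cas: "cas_poly p \<in> left_ideal_of J \<longleftrightarrow> p \<in> J" for p
    using zero by (auto simp: left_ideal_of_def rep_cas_poly cyclic_vector_def split: if_splits)
  have "\<one>\<^bsub>Uq q m\<^esub> \<notin> I"
    using I.one_imp_carrier I(2) by (auto simp: Z)
  then have "1 \<notin> left_ideal_of J"
    using cas[of 1] by (simp add: J_def U_class_1)
  then obtain V :: "(U_elem, 'v) module" and v where v: "left_module (Uq q m) V" "v \<in> carrier V"
    "v \<noteq> \<zero>\<^bsub>V\<^esub>" "U_E q m \<odot>\<^bsub>V\<^esub> v = U_scalar q m e \<odot>\<^bsub>V\<^esub> v"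
    "carrier V = {u \<odot>\<^bsub>V\<^esub> v | u. u \<in> carrier (Uq q m)}" "vector_ideal V v = left_ideal_of J"
    using module_of_whittaker_left_ideal[OF L _ small] by blast
  have "V \<in> whittaker_modules q m \<eta>"
    using v unfolding whittaker_modules_def whittaker_vector_def \<eta>_E by blast
  moreover have "U_class q m (cas_poly p) \<in> central_annihilator q m V \<longleftrightarrow> U_class q m (cas_poly p) \<in> I" for p
    using central_annihilator_cyclic[OF v(1,2,5)] cas by (simp add: v(6) J_def)
  then have "central_annihilator q m V = I"
    using I.a_subset center_eq_cas_poly by (auto simp: central_annihilator_def Z)
  ultimately show ?thesis by blast
qed

end

end

theorem theorem3p3:
  fixes q :: complex and m :: nat and \<eta> :: "U_elem \<Rightarrow> complex"
  assumes "q \<noteq> 0" and "q\<^sup>2 \<noteq> 1"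
    and "\<forall>n>0. q ^ n \<noteq> 1"
    and "nonsingular_character q m \<eta>"
    and "carrier (Uq q m) \<lesssim> (UNIV :: 'v set)"
  shows "\<exists>\<Phi> :: (U_elem, 'v) module set \<Rightarrow> U_elem set.
    (\<forall>V \<in> whittaker_modules q m \<eta>.
       \<Phi> (whittaker_equiv q m \<eta> `` {V}) = central_annihilator q m V) \<and>
    bij_betw \<Phi>
      (whittaker_modules q m \<eta> // whittaker_equiv q m \<eta>)
      {I. ideal I (center_ring (Uq q m)) \<and> I \<noteq> ring_center (Uq q m)}"
proof -
  interpret generic_whittaker q m "\<eta> (U_E q m)"
    using assms by unfold_locales (auto simp: nonsingular_character_def)
  let ?M = "whittaker_modules q m \<eta> :: (U_elem, 'v) module set"
  let ?R = "whittaker_equiv q m \<eta> :: ((U_elem, 'v) module \<times> (U_elem, 'v) module) set"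
  define \<Phi> where "\<Phi> C = central_annihilator q m (SOME V. V \<in> C)" for C :: "(U_elem, 'v) module set"
  have equiv: "equiv ?M ?R" by (rule equiv_whittaker_equiv)
  have invariant: "central_annihilator q m V = central_annihilator q m W" if "(V, W) \<in> ?R" for V W
    using that annihilator_iso[of "Uq q m" V W]
    by (auto simp: whittaker_equiv_def whittaker_modules_def central_annihilator_def)
  have \<Phi>: "\<Phi> (?R `` {V}) = central_annihilator q m V" if "V \<in> ?M" for V
  proof -
    have "(SOME W. W \<in> ?R `` {V}) \<in> ?R `` {V}"
      using equiv_class_self[OF equiv that] by (rule someI)
    then show ?thesis using invariant by (auto simp: \<Phi>_def)
  qed
  have "inj_on \<Phi> (?M // ?R)"
  proof (rule inj_onI)
    fix C D assume "C \<in> ?M // ?R" "D \<in> ?M // ?R" and eq: "\<Phi> C = \<Phi> D"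
    then obtain V W where V: "V \<in> ?M" "C = ?R `` {V}" and W: "W \<in> ?M" "D = ?R `` {W}"
      by (auto elim!: quotientE)
    then have "(V, W) \<in> ?R"
      using eq by (intro central_annihilator_determines_module) (simp_all add: \<Phi>)
    then show "C = D"
      using V W equiv_class_eq[OF equiv] by simp
  qed
  moreover have "\<Phi> ` (?M // ?R) = {I. ideal I (center_ring (Uq q m)) \<and> I \<noteq> ring_center (Uq q m)}"
  proof (intro subset_antisym subsetI)
    fix I assume "I \<in> \<Phi> ` (?M // ?R)"
    then obtain V where "V \<in> ?M" "I = central_annihilator q m V"
      using \<Phi> by (auto elim!: quotientE)
    then show "I \<in> {I. ideal I (center_ring (Uq q m)) \<and> I \<noteq> ring_center (Uq q m)}"
      using central_annihilator_ideal[of \<eta> V] by simp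
  next
    fix I assume "I \<in> {I. ideal I (center_ring (Uq q m)) \<and> I \<noteq> ring_center (Uq q m)}"
    then obtain V where "V \<in> ?M" "central_annihilator q m V = I"
      using central_ideal_realized[of \<eta> I, OF refl _ _ assms(5)] by auto
    then show "I \<in> \<Phi> ` (?M // ?R)"
      using \<Phi> by (metis imageI quotientI)
  qed
  ultimately show ?thesis
    using \<Phi> by (intro exI[of _ \<Phi>]) (simp add: bij_betw_def)
qed

end
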